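(* Let $M,N\ge0$ be integers. Let $X_1,\ldots,X_M,Y_1,\ldots,Y_N$ be independent random variables with $X_i\sim N(0,\sigma_{X_i}^2)$ and $Y_j\sim N(0,\sigma_{Y_j}^2)$, let $Z=X/Y$ with $X=X_1\cdots X_M$ and $Y=Y_1\cdots Y_N$, and let $Q(p)=F_Z^{-1}(p)$, $0<p<1$, be the quantile function of $Z$, where $F_Z(z)=\mathbb{P}(Z\le z)$. (i) Suppose $M\ge0$ and $N\ge1$. Then, as $p\to0$, $$Q(p)\sim-\frac{2^{(M+N-2)/2}\sigma_M}{\pi^{(M+N)/2}s_N(N-1)!}\,\frac{\big(\ln(1/p)\big)^{N-1}}{p}.$$ (ii) Suppose $M\ge1$ and $N=0$. Then, as $p\to0$, $$Q(p)\sim-\bigg(\frac{2\sigma_M^{2/M}}{M}\ln\big(1/p\big)\bigg)^{M/2}.$$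
   Context: All standard deviations $\sigma_{X_i},\sigma_{Y_j}$ are positive. Notation: $\sigma_M=\sigma_{X_1}\cdots\sigma_{X_M}$ and $s_N=\sigma_{Y_1}\cdots\sigma_{Y_N}$. Empty products are $1$: thus $\sigma_0=1$, $s_0=1$, $X=1$ when $M=0$, and $Y=1$ when $N=0$. The notation $f\sim g$ means that the ratio $f/g$ tends to $1$ in the stated limit (here $p\downarrow0$). *)

theory Defs
  imports "HOL-Probability.Probability"
begin

definition quantile :: "real measure \<Rightarrow> real \<Rightarrow> real" where
  "quantile \<mu> p = Inf {z. p \<le> cdf \<mu> z}"

text \<open>Where the distribution function is one-to-one and attains the value \<open>p\<close>, the quantile
  function is the ordinary inverse function of the distribution function.\<close>

lemma quantile_eq_inv_cdf:
  assumes "real_distribution \<mu>" and inj: "inj (cdf \<mu>)" and "p \<in> range (cdf \<mu>)"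
  shows "quantile \<mu> p = inv (cdf \<mu>) p"
proof -
  interpret real_distribution \<mu> by fact
  obtain z where z: "cdf \<mu> z = p" using assms(3) by auto
  have "p \<le> cdf \<mu> x \<longleftrightarrow> z \<le> x" for x
    by (metis z cdf_nondecreasing inj injD antisym linear order_refl)
  then have "{x. p \<le> cdf \<mu> x} = {z..}" by auto
  then have "quantile \<mu> p = z" by (simp add: quantile_def)
  also have "z = inv (cdf \<mu>) p" using inv_f_f[OF inj] z by metis
  finally show ?thesis .
qed

end

theory Submission
  imports Defs "HOL-Real_Asymp.Real_Asymp"
begin

text \<open>
  If \<open>\<bar>U\<bar>\<close> has tail \<open>\<sim> C (ln z)^k / z\<close> and \<open>W\<close> is an independent centred normal variable, then
  conditioning on \<open>W\<close> shows that \<open>\<bar>U / W\<bar>\<close> has a tail of the same kind with \<open>k\<close> raised by one,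
  because \<open>(ln u)^k / u\<close> integrates to \<open>(ln u)^(k+1) / (k+1)\<close> and only the density of \<open>W\<close> at 0 matters,
  while \<open>\<bar>U W\<bar>\<close> keeps \<open>k\<close> and has \<open>C\<close> multiplied by \<open>E \<bar>W\<bar>\<close>, by dominated convergence.
  Starting from \<open>1 / Y\<^sub>1\<close> this gives the tail of \<open>\<bar>Z\<bar>\<close> for \<open>N \<ge> 1\<close>; symmetry halves it, and
  inverting \<open>p = K (ln z)^k / z\<close> gives the quantile.

  For \<open>N = 0\<close> the logarithm of the tail suffices. A product of normalised variables of size at least
  \<open>v^M\<close> forces the sum of their squares to be at least \<open>M v^2\<close> (arithmetic-geometric mean), which has
  probability at most \<open>const * exp (- \<theta> M v^2)\<close> for every \<open>\<theta> < 1/2\<close>; conversely the product is below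
  \<open>- v^M\<close> when one factor lies in \<open>[- v - 1, - v]\<close> and all the others in \<open>[v, v + 1]\<close>.
\<close>

subsection \<open>Asymptotic inversion of distribution functions\<close>

text \<open>Monotonicity of the distribution function makes \<open>- (c * q p)\<close> a lower bound
  of the set defining the quantile when \<open>cdf\<close> is below \<open>p\<close> there, and a
  member of that set otherwise. The ratio of the quantile to \<open>- q p\<close> is thus squeezed
  between factors arbitrarily close to 1.\<close>

lemma quantile_asymp_equiv_neg:
  fixes \<mu> :: "real measure" and q :: "real \<Rightarrow> real"
  assumes "real_distribution \<mu>"
    and q: "\<forall>\<^sub>F p in at_right 0. 0 < q p"
    and below: "\<And>c. 1 < c \<Longrightarrow> \<forall>\<^sub>F p in at_right 0. cdf \<mu> (- (c * q p)) < p"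
    and above: "\<And>c. 0 < c \<Longrightarrow> c < 1 \<Longrightarrow> \<forall>\<^sub>F p in at_right 0. p \<le> cdf \<mu> (- (c * q p))"
  shows "quantile \<mu> \<sim>[at_right 0] (\<lambda>p. - q p)"
proof -
  interpret real_distribution \<mu> by fact
  have lower: "- (c * q p) \<le> z" if "cdf \<mu> (- (c * q p)) < p" "p \<le> cdf \<mu> z" for c p z
    using cdf_nondecreasing[of z "- (c * q p)"] that by linarith
  have Inf_bounds: "quantile \<mu> p / - q p \<in> {b..c}"
    if "0 < q p" "cdf \<mu> (- (c * q p)) < p" "p \<le> cdf \<mu> (- (b * q p))" for b c p
  proof -
    have "quantile \<mu> p \<le> - (b * q p)"
      unfolding quantile_def using that(3) lower[OF that(2)]
      by (intro cInf_lower) (auto intro!: bdd_belowI)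
    moreover have "- (c * q p) \<le> quantile \<mu> p"
      unfolding quantile_def using that(3) lower[OF that(2)]
      by (intro cInf_greatest) auto
    ultimately show ?thesis using that(1) by (auto simp: field_simps)
  qed
  have "((\<lambda>p. quantile \<mu> p / - q p) \<longlongrightarrow> 1) (at_right 0)"
  proof (rule order_tendstoI)
    fix a :: real assume "a < 1"
    \<comment> \<open>Midpoint of \<open>max a 0\<close> and 1; the maximum keeps \<open>b\<close>
      positive, as \<open>above\<close> demands, even for negative \<open>a\<close>.\<close>
    define b where "b = (max a 0 + 1) / 2"
    have b: "0 < b" "b < 1" "a < b" using \<open>a < 1\<close> by (auto simp: b_def)
    \<comment> \<open>Only \<open>b\<close> matters for this bound; the factor 2 just certifies that
      the set is bounded below.\<close>
    have "1 < (2::real)" by simp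
    from q below[OF this] above[OF b(1,2)]
    show "\<forall>\<^sub>F p in at_right 0. a < quantile \<mu> p / - q p"
    proof eventually_elim
      case (elim p)
      from Inf_bounds[OF elim] b show ?case by auto
    qed
  next
    fix a :: real assume "1 < a"
    define c where "c = (a + 1) / 2"
    have c: "1 < c" "c < a" using \<open>1 < a\<close> by (auto simp: c_def)
    \<comment> \<open>Here 1/2 just certifies that the set is nonempty.\<close>
    have "(0::real) < 1 / 2" "(1::real) / 2 < 1" by simp_all
    from q below[OF c(1)] above[OF this]
    show "\<forall>\<^sub>F p in at_right 0. quantile \<mu> p / - q p < a"
    proof eventually_elim
      case (elim p)
      from Inf_bounds[OF elim] c show ?case by auto
    qed
  qed
  then show ?thesis by (rule asymp_equivI')
qed

text \<open>The argument \<open>z\<close> of \<open>G\<close> satisfies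
  \<open>ln z \<sim> ln (1 / p)\<close>, because the logarithmic power and the constants contribute
  lower order terms. Hence \<open>G z\<close> behaves like \<open>K * ln (1 / p) ^ k / z\<close>,
  which equals \<open>p / c\<close>.\<close>

lemma tendsto_log_power_tail_at_inverse:
  fixes G :: "real \<Rightarrow> real"
  assumes G: "((\<lambda>z. G z * z / ln z ^ k) \<longlongrightarrow> K) at_top" and K: "0 < K" and c: "0 < c"
  shows "((\<lambda>p. G (c * (K * (ln (1 / p) ^ k / p))) / p) \<longlongrightarrow> 1 / c) (at_right 0)"
proof -
  define z where "z = (\<lambda>p. c * (K * (ln (1 / p) ^ k / p)))"
  have z: "filterlim z at_top (at_right 0)"
    unfolding z_def using K c by real_asymp
  have ev: "\<forall>\<^sub>F p::real in at_right 0. p \<in> {0<..<1}"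
    by (rule eventually_at_right_real) simp
  have *: "((\<lambda>p. ln (z p) / ln (1 / p)) \<longlongrightarrow> 1) (at_right 0)"
    unfolding z_def using K c by real_asymp
  have "((\<lambda>p. G (z p) * z p / ln (z p) ^ k * (ln (z p) / ln (1 / p)) ^ k / (c * K)) \<longlongrightarrow> K * 1 ^ k / (c * K)) (at_right 0)"
    using K c by (intro tendsto_intros filterlim_compose[OF G z] *) auto
  then have "((\<lambda>p. G (z p) * z p / ln (z p) ^ k * (ln (z p) / ln (1 / p)) ^ k / (c * K)) \<longlongrightarrow> 1 / c) (at_right 0)"
    using K by simp
  moreover have "\<forall>\<^sub>F p in at_right 0. G (z p) * z p / ln (z p) ^ k * (ln (z p) / ln (1 / p)) ^ k / (c * K) = G (z p) / p"
    using ev z[unfolded filterlim_at_top_dense, rule_format, of 1]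
  proof eventually_elim
    case (elim p)
    then have "ln (z p) > 0" "ln (1 / p) > 0" by (auto simp: ln_div)
    then show ?case using elim K c
      by (simp add: power_divide) (simp add: z_def field_simps)
  qed
  ultimately show ?thesis
    unfolding z_def by (rule Lim_transform_eventually)
qed

text \<open>The limit \<open>1 / c\<close> of the preceding lemma lies below 1 for
  \<open>c > 1\<close> and above 1 for \<open>c < 1\<close>, which gives the two comparisons with
  \<open>p\<close> needed for the inversion.\<close>

lemma quantile_asymp_equiv_log_power_tail:
  fixes \<mu> :: "real measure"
  assumes "real_distribution \<mu>"
    and G: "((\<lambda>z. cdf \<mu> (- z) * z / ln z ^ k) \<longlongrightarrow> K) at_top" and K: "0 < K"
  shows "quantile \<mu> \<sim>[at_right 0] (\<lambda>p. - (K * (ln (1 / p) ^ k / p)))"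
proof (rule quantile_asymp_equiv_neg)
  have ev: "\<forall>\<^sub>F p::real in at_right 0. p \<in> {0<..<1}"
    by (rule eventually_at_right_real) simp
  then show "\<forall>\<^sub>F p in at_right 0. 0 < K * (ln (1 / p) ^ k / p)"
    by eventually_elim (use K in \<open>auto simp: ln_div intro!: mult_pos_pos divide_pos_pos zero_less_power\<close>)
  fix c :: real
  {
    assume c: "1 < c"
    then have "0 < c" "1 / c < 1" by simp_all
    from order_tendstoD(2)[OF tendsto_log_power_tail_at_inverse[OF G K this(1)] this(2)] ev
    show "\<forall>\<^sub>F p in at_right 0. cdf \<mu> (- (c * (K * (ln (1 / p) ^ k / p)))) < p"
      by eventually_elim (simp add: pos_divide_less_eq)
  next
    assume c: "0 < c" "c < 1"
    then have "1 < 1 / c" by simp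
    from order_tendstoD(1)[OF tendsto_log_power_tail_at_inverse[OF G K c(1)] this] ev
    show "\<forall>\<^sub>F p in at_right 0. p \<le> cdf \<mu> (- (c * (K * (ln (1 / p) ^ k / p))))"
      by eventually_elim (simp add: pos_less_divide_eq)
  }
qed fact

subsection \<open>Normal mixtures of tail functions\<close>

lemma normal_density_antimono_abs:
  assumes "0 < s" "\<bar>x\<bar> \<le> \<bar>y\<bar>"
  shows "normal_density 0 s y \<le> normal_density 0 s x"
proof -
  have "x\<^sup>2 \<le> y\<^sup>2" using assms(2) by (simp add: abs_le_square_iff)
  then show ?thesis
    using assms(1) by (auto simp: normal_density_def intro!: divide_right_mono)
qed

text \<open>This integral is what raises the power of the logarithm by one; the factor 2 comes from
  evenness in \<open>y\<close>.\<close>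

lemma has_bochner_integral_log_power_abs:
  fixes z \<alpha> \<beta> :: real
  assumes "0 < z" "0 < \<alpha>" "\<alpha> \<le> \<beta>"
  shows "has_bochner_integral lborel
    (\<lambda>y. ln (z * \<bar>y\<bar>) ^ k / (z * \<bar>y\<bar>) * indicator {\<alpha>..\<beta>} \<bar>y\<bar>)
    (2 * ((ln (z * \<beta>) ^ (k + 1) - ln (z * \<alpha>) ^ (k + 1)) / (z * real (k + 1))))"
proof -
  define F where "F = (\<lambda>y. ln (z * y) ^ (k + 1) / (z * real (k + 1)))"
  have "has_bochner_integral lborel (\<lambda>y. ln (z * y) ^ k / (z * y) * indicator {\<alpha>..\<beta>} y) (F \<beta> - F \<alpha>)"
  proof (rule has_bochner_integral_FTC_Icc_real)
    fix y assume "\<alpha> \<le> y" "y \<le> \<beta>"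
    then have y: "0 < y" using assms by simp
    show "DERIV F y :> ln (z * y) ^ k / (z * y)"
    proof -
      have "DERIV (\<lambda>y. ln (z * y)) y :> 1 / y"
        using y assms by (auto intro!: derivative_eq_intros)
      from DERIV_cdivide[OF DERIV_power[OF this, of "k + 1"], of "z * real (k + 1)"] show ?thesis
        unfolding F_def by (rule DERIV_cong) (simp del: of_nat_Suc)
    qed
    show "isCont (\<lambda>y. ln (z * y) ^ k / (z * y)) y"
      using y assms by (auto intro!: continuous_intros)
  qed fact
  \<comment> \<open>As \<alpha> is positive, the indicator already confines \<open>y\<close> to the
    right half-line, so this is one half of an even integrand.\<close>
  also have "(\<lambda>y. ln (z * y) ^ k / (z * y) * indicator {\<alpha>..\<beta>} y) =
     (\<lambda>y. indicator {0..} y *\<^sub>R (ln (z * \<bar>y\<bar>) ^ k / (z * \<bar>y\<bar>) * indicator {\<alpha>..\<beta>} \<bar>y\<bar>))"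
    using assms by (auto simp: fun_eq_iff split: split_indicator)
  finally have "has_bochner_integral lborel
      (\<lambda>y. ln (z * \<bar>y\<bar>) ^ k / (z * \<bar>y\<bar>) * indicator {\<alpha>..\<beta>} \<bar>y\<bar>) (2 *\<^sub>R (F \<beta> - F \<alpha>))"
    by (rule has_bochner_integral_even_function) simp
  then show ?thesis by (simp add: F_def diff_divide_distrib)
qed

text \<open>The estimates on mixtures use only these properties of a two-sided tail, so they are
  carried out without a probability space.\<close>

locale tail_function =
  fixes T :: "real \<Rightarrow> real"
  assumes antimono: "antimono T" and nonneg: "0 \<le> T u" and le_1: "T u \<le> 1"
begin

lemma measurable [measurable]: "T \<in> borel_measurable borel"
proof -
  have "(\<lambda>u. - T u) \<in> borel_measurable borel"
    using antimono by (intro borel_measurable_mono) (auto simp: monotone_def)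
  then show ?thesis by simp
qed

lemma integrable_density:
  assumes "0 < s" and [measurable]: "g \<in> borel_measurable borel"
  shows "integrable lborel (\<lambda>y. normal_density 0 s y * T (g y))"
proof (rule Bochner_Integration.integrable_bound)
  show "integrable lborel (normal_density 0 s)"
    using assms(1) by (rule integrable_normal_density)
qed (auto simp: abs_mult nonneg le_1 intro!: mult_left_le)

text \<open>The three summands come from three regions. For \<open>\<bar>y\<bar> \<le> a / z\<close>
  the tail is at most 1 and the density at most its value at 0; up to
  \<open>\<bar>y\<bar> = 1\<close> the assumed bound integrates to a power of the logarithm; beyond
  1 monotonicity leaves \<open>T z\<close> times a mass of at most 1.\<close>

lemma integral_le_of_log_power_bound:
  assumes "0 < s" "1 < a" "a \<le> z" "0 \<le> C"
    and T: "\<And>u. a \<le> u \<Longrightarrow> T u \<le> C * (ln u ^ k / u)"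
  shows "(\<integral>y. normal_density 0 s y * T (z * \<bar>y\<bar>) \<partial>lborel) * z \<le>
    2 * normal_density 0 s 0 * a + 2 * normal_density 0 s 0 * C / real (k + 1) * ln z ^ (k + 1) + T z * z"
proof -
  let ?\<phi> = "normal_density 0 s"
  have z: "0 < z" using assms by simp
  let ?L = "\<lambda>y. ln (z * \<bar>y\<bar>) ^ k / (z * \<bar>y\<bar>) * indicator {a/z..1} \<bar>y\<bar>"
  note L = has_bochner_integral_log_power_abs[of z "a/z" 1 k]
  have I: "has_bochner_integral lborel ?L (2 * ((ln (z * 1) ^ (k + 1) - ln (z * (a/z)) ^ (k + 1)) / (z * real (k + 1))))"
    using L z assms by simp
  have J: "has_bochner_integral lborel (indicator {-(a/z)..a/z}) (2 * (a / z))"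
    using has_bochner_integral_real_indicator[of "{-(a/z)..a/z}" lborel] z assms by simp
  have "has_bochner_integral lborel ?\<phi> 1"
    using assms(1) by (simp add: has_bochner_integral_iff)
  note B = has_bochner_integral_add[OF has_bochner_integral_add[OF
      has_bochner_integral_mult_right[OF J, of "?\<phi> 0"] has_bochner_integral_mult_right[OF I, of "?\<phi> 0 * C"]]
      has_bochner_integral_mult_left[OF this, of "T z"]]
  have "(\<integral>y. ?\<phi> y * T (z * \<bar>y\<bar>) \<partial>lborel) \<le>
    (\<integral>y. ?\<phi> 0 * indicator {-(a/z)..a/z} y + ?\<phi> 0 * C * ?L y + ?\<phi> y * T z \<partial>lborel)"
  proof (rule integral_mono)
    show "integrable lborel (\<lambda>y. ?\<phi> y * T (z * \<bar>y\<bar>))"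
      using assms by (intro integrable_density) auto
    show "integrable lborel (\<lambda>y. ?\<phi> 0 * indicator {-(a/z)..a/z} y + ?\<phi> 0 * C * ?L y + ?\<phi> y * T z)"
      using B by (rule integrable.intros)
    fix y :: real
    have \<phi>: "?\<phi> y \<le> ?\<phi> 0" using assms by (intro normal_density_antimono_abs) auto
    have L0: "0 \<le> ?L y" using z assms by (auto simp: indicator_def field_simps intro!: divide_nonneg_nonneg zero_le_power)
    have L1: "0 \<le> ?\<phi> 0 * C * ?L y"
      using mult_nonneg_nonneg[OF mult_nonneg_nonneg[OF normal_density_nonneg assms(4)] L0] .
    consider "\<bar>y\<bar> \<le> a / z" | "a / z \<le> \<bar>y\<bar>" "\<bar>y\<bar> \<le> 1" | "1 \<le> \<bar>y\<bar>" by linarith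
    then show "?\<phi> y * T (z * \<bar>y\<bar>) \<le> ?\<phi> 0 * indicator {-(a/z)..a/z} y + ?\<phi> 0 * C * ?L y + ?\<phi> y * T z"
    proof cases
      case 1
      then have "?\<phi> y * T (z * \<bar>y\<bar>) \<le> ?\<phi> 0 * indicator {-(a/z)..a/z} y"
        using \<phi> nonneg le_1 by (auto simp: indicator_def abs_le_iff intro: order_trans[OF mult_left_le])
      moreover have "0 \<le> ?\<phi> 0 * C * ?L y" "0 \<le> ?\<phi> y * T z"
        using L1 nonneg by auto
      ultimately show ?thesis by linarith
    next
      case 2
      then have "T (z * \<bar>y\<bar>) \<le> C * (ln (z * \<bar>y\<bar>) ^ k / (z * \<bar>y\<bar>))"
        using z by (intro T) (auto simp: field_simps)
      with 2 have "T (z * \<bar>y\<bar>) \<le> C * ?L y" by simp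
      then have "?\<phi> y * T (z * \<bar>y\<bar>) \<le> ?\<phi> 0 * (C * ?L y)"
        using \<phi> nonneg by (intro mult_mono) auto
      moreover have "0 \<le> ?\<phi> 0 * indicator {-(a/z)..a/z} y" "0 \<le> ?\<phi> y * T z"
        using nonneg by (auto intro!: mult_nonneg_nonneg)
      ultimately show ?thesis unfolding mult.assoc by linarith
    next
      case 3
      then have "T (z * \<bar>y\<bar>) \<le> T z" using z by (intro antimonoD[OF antimono]) auto
      then have "?\<phi> y * T (z * \<bar>y\<bar>) \<le> ?\<phi> y * T z" by (intro mult_left_mono) auto
      moreover have "0 \<le> ?\<phi> 0 * indicator {-(a/z)..a/z} y" "0 \<le> ?\<phi> 0 * C * ?L y"
        using L1 by auto
      ultimately show ?thesis by linarith
    qed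
  qed
  also have "\<dots> = ?\<phi> 0 * (2 * (a / z)) + ?\<phi> 0 * C * (2 * ((ln (z * 1) ^ (k + 1) - ln (z * (a/z)) ^ (k + 1)) / (z * real (k + 1)))) + 1 * T z"
    using B by (simp add: has_bochner_integral_iff)
  finally have "(\<integral>y. ?\<phi> y * T (z * \<bar>y\<bar>) \<partial>lborel) * z \<le>
    (?\<phi> 0 * (2 * (a / z)) + ?\<phi> 0 * C * (2 * ((ln (z * 1) ^ (k + 1) - ln (z * (a/z)) ^ (k + 1)) / (z * real (k + 1)))) + 1 * T z) * z"
    using z by (intro mult_right_mono) auto
  also have "\<dots> = 2 * ?\<phi> 0 * a + 2 * ?\<phi> 0 * C / real (k + 1) * (ln z ^ (k + 1) - ln a ^ (k + 1)) + T z * z"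
    using z by (simp add: field_simps del: of_nat_add of_nat_Suc)
  \<comment> \<open>The subtracted power of \<open>ln a\<close> is nonnegative since
    \<open>1 < a\<close>.\<close>
  also have "\<dots> \<le> 2 * ?\<phi> 0 * a + 2 * ?\<phi> 0 * C / real (k + 1) * ln z ^ (k + 1) + T z * z"
    using assms by (intro add_mono mult_left_mono order_refl) auto
  finally show ?thesis .
qed

text \<open>Only the window \<open>a / z \<le> \<bar>y\<bar> \<le> \<delta>\<close> is kept; there
  the density is at least its value at \<delta>, and the assumed bound can be integrated.\<close>

lemma integral_ge_of_log_power_bound:
  assumes "0 < s" "1 < a" "0 < \<delta>" "a \<le> z * \<delta>" "0 \<le> C" and z: "0 < z"
    and T: "\<And>u. a \<le> u \<Longrightarrow> C * (ln u ^ k / u) \<le> T u"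
  shows "2 * normal_density 0 s \<delta> * C / real (k + 1) * (ln (z * \<delta>) ^ (k + 1) - ln a ^ (k + 1)) \<le>
    (\<integral>y. normal_density 0 s y * T (z * \<bar>y\<bar>) \<partial>lborel) * z"
proof -
  let ?\<phi> = "normal_density 0 s"
  let ?L = "\<lambda>y. ln (z * \<bar>y\<bar>) ^ k / (z * \<bar>y\<bar>) * indicator {a/z..\<delta>} \<bar>y\<bar>"
  have I: "has_bochner_integral lborel ?L (2 * ((ln (z * \<delta>) ^ (k + 1) - ln (z * (a/z)) ^ (k + 1)) / (z * real (k + 1))))"
    using assms by (intro has_bochner_integral_log_power_abs) (auto simp: field_simps)
  note B = has_bochner_integral_mult_right[OF I, of "?\<phi> \<delta> * C"]
  have "2 * ?\<phi> \<delta> * C / real (k + 1) * (ln (z * \<delta>) ^ (k + 1) - ln a ^ (k + 1)) =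
      (?\<phi> \<delta> * C * (2 * ((ln (z * \<delta>) ^ (k + 1) - ln (z * (a/z)) ^ (k + 1)) / (z * real (k + 1))))) * z"
    using z by (simp add: field_simps del: of_nat_add of_nat_Suc)
  also have "\<dots> = (\<integral>y. ?\<phi> \<delta> * C * ?L y \<partial>lborel) * z"
    using B by (simp add: has_bochner_integral_iff)
  also have "\<dots> \<le> (\<integral>y. ?\<phi> y * T (z * \<bar>y\<bar>) \<partial>lborel) * z"
  proof (rule mult_right_mono[OF integral_mono])
    show "integrable lborel (\<lambda>y. ?\<phi> y * T (z * \<bar>y\<bar>))"
      using assms by (intro integrable_density) auto
    show "integrable lborel (\<lambda>y. ?\<phi> \<delta> * C * ?L y)"
      using B by (simp add: has_bochner_integral_iff)
    fix y :: real
    show "?\<phi> \<delta> * C * ?L y \<le> ?\<phi> y * T (z * \<bar>y\<bar>)"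
    proof (cases "\<bar>y\<bar> \<in> {a/z..\<delta>}")
      case True
      then have "C * ?L y \<le> T (z * \<bar>y\<bar>)"
        using z T[of "z * \<bar>y\<bar>"] by (simp add: field_simps)
      moreover have "?\<phi> \<delta> \<le> ?\<phi> y"
        using True assms by (intro normal_density_antimono_abs) auto
      moreover have "0 \<le> C * ?L y"
        using True assms by (auto simp: field_simps intro!: mult_nonneg_nonneg divide_nonneg_nonneg zero_le_power)
      ultimately have "?\<phi> \<delta> * (C * ?L y) \<le> ?\<phi> y * T (z * \<bar>y\<bar>)" by (intro mult_mono) auto
      then show ?thesis by (simp add: mult.assoc)
    qed (simp add: nonneg)
  qed (use z in auto)
  finally show ?thesis .
qed

text \<open>After division by \<open>ln z ^ (k + 1)\<close> only the middle region of the upper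
  bound survives. The lower bound has the same limit, except that the density is taken at \<delta>,
  which can be chosen close to 0.\<close>

lemma log_power_tail_divide_normal:
  assumes T: "((\<lambda>u. T u * u / ln u ^ k) \<longlongrightarrow> C) at_top" and "0 < C" "0 < s"
  shows "((\<lambda>z. (\<integral>y. normal_density 0 s y * T (z * \<bar>y\<bar>) \<partial>lborel) * z / ln z ^ (k + 1)) \<longlongrightarrow>
    2 * normal_density 0 s 0 * C / real (k + 1)) at_top"
proof (rule order_tendstoI)
  let ?\<phi> = "normal_density 0 s"
  fix b assume b: "2 * ?\<phi> 0 * C / real (k + 1) < b"
  \<comment> \<open>By continuity there is a constant \<open>D\<close> slightly above
    \<open>C\<close> that still keeps the limit below \<open>b\<close>.\<close>
  have "((\<lambda>C. 2 * ?\<phi> 0 * C / real (k + 1)) \<longlongrightarrow> 2 * ?\<phi> 0 * C / real (k + 1)) (at_right C)"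
    by (intro tendsto_intros) auto
  from eventually_happens[OF eventually_conj[OF order_tendstoD(2)[OF this b] eventually_at_right_less]]
  obtain D where D: "2 * ?\<phi> 0 * D / real (k + 1) < b" "C < D" by auto
  from order_tendstoD(2)[OF T D(2)]
  obtain a0 where a0: "\<And>u. a0 \<le> u \<Longrightarrow> T u * u / ln u ^ k < D"
    by (auto simp: eventually_at_top_linorder)
  \<comment> \<open>The floor 2 makes \<open>ln u\<close> positive, so that the bound can be cleared
    of denominators.\<close>
  define a where "a = max a0 2"
  have a: "1 < a" by (simp add: a_def)
  have Tle: "T u \<le> D * (ln u ^ k / u)" if "a \<le> u" for u
  proof -
    have "0 < u" "0 < ln u ^ k" using that a by (auto intro!: zero_less_power)
    then show ?thesis using a0[of u] that by (simp add: a_def field_simps)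
  qed
  have "((\<lambda>z. 2 * ?\<phi> 0 * a / ln z ^ (k + 1) + 2 * ?\<phi> 0 * D / real (k + 1) + (T z * z / ln z ^ k) / ln z) \<longlongrightarrow>
     0 + 2 * ?\<phi> 0 * D / real (k + 1) + 0) at_top"
    by (intro tendsto_intros tendsto_divide_0[OF tendsto_const] tendsto_divide_0[OF T]
        filterlim_at_top_imp_at_infinity filterlim_pow_at_top ln_at_top) auto
  then have "\<forall>\<^sub>F z in at_top. 2 * ?\<phi> 0 * a / ln z ^ (k + 1) + 2 * ?\<phi> 0 * D / real (k + 1) + (T z * z / ln z ^ k) / ln z < b"
    using D by (intro order_tendstoD(2)) auto
  with eventually_ge_at_top[of a]
  show "\<forall>\<^sub>F z in at_top. (\<integral>y. ?\<phi> y * T (z * \<bar>y\<bar>) \<partial>lborel) * z / ln z ^ (k + 1) < b"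
  proof eventually_elim
    case (elim z)
    have ln: "0 < ln z" using elim a by simp
    have "(\<integral>y. ?\<phi> y * T (z * \<bar>y\<bar>) \<partial>lborel) * z / ln z ^ (k + 1) \<le>
      (2 * ?\<phi> 0 * a + 2 * ?\<phi> 0 * D / real (k + 1) * ln z ^ (k + 1) + T z * z) / ln z ^ (k + 1)"
      using ln assms D elim a by (intro divide_right_mono integral_le_of_log_power_bound Tle) auto
    also have "\<dots> = 2 * ?\<phi> 0 * a / ln z ^ (k + 1) + 2 * ?\<phi> 0 * D / real (k + 1) + (T z * z / ln z ^ k) / ln z"
      using ln by (simp add: add_divide_distrib)
    finally show ?case using elim by linarith
  qed
next
  let ?\<phi> = "normal_density 0 s"
  fix b assume b: "b < 2 * ?\<phi> 0 * C / real (k + 1)"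
  have "((\<lambda>C. 2 * ?\<phi> 0 * C / real (k + 1)) \<longlongrightarrow> 2 * ?\<phi> 0 * C / real (k + 1)) (at_left C)"
    by (intro tendsto_intros) auto
  moreover have "\<forall>\<^sub>F D in at_left C. D \<in> {0<..<C}" using \<open>0 < C\<close> by (rule eventually_at_left_real)
  ultimately have "\<forall>\<^sub>F D in at_left C. b < 2 * ?\<phi> 0 * D / real (k + 1) \<and> D \<in> {0<..<C}"
    by (intro eventually_conj order_tendstoD(1)) (use b in auto)
  from eventually_happens[OF this]
  obtain D where D: "b < 2 * ?\<phi> 0 * D / real (k + 1)" "0 < D" "D < C" by auto
  \<comment> \<open>Continuity of the density at 0 allows the window radius \<delta> to be fixed
    before \<open>z\<close> grows.\<close>
  have "((\<lambda>\<delta>. 2 * ?\<phi> \<delta> * D / real (k + 1)) \<longlongrightarrow> 2 * ?\<phi> 0 * D / real (k + 1)) (at_right 0)"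
    unfolding normal_density_def using assms(3) by (intro tendsto_intros) auto
  from eventually_happens[OF eventually_conj[OF order_tendstoD(1)[OF this D(1)] eventually_at_right_less]]
  obtain \<delta> where \<delta>: "b < 2 * ?\<phi> \<delta> * D / real (k + 1)" "0 < \<delta>" by auto
  from order_tendstoD(1)[OF T D(3)]
  obtain a0 where a0: "\<And>u. a0 \<le> u \<Longrightarrow> D < T u * u / ln u ^ k"
    by (auto simp: eventually_at_top_linorder)
  define a where "a = max a0 2"
  have a: "1 < a" by (simp add: a_def)
  have Tge: "D * (ln u ^ k / u) \<le> T u" if "a \<le> u" for u
  proof -
    have "0 < u" "0 < ln u ^ k" using that a by (auto intro!: zero_less_power)
    then show ?thesis using a0[of u] that by (simp add: a_def field_simps)
  qed
  \<comment> \<open>A fixed rescaling of \<open>z\<close> is invisible to the logarithm in the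
    limit.\<close>
  have lim1: "((\<lambda>z. ln (z * \<delta>) / ln z) \<longlongrightarrow> 1) at_top"
    using \<delta>(2) by real_asymp
  have "((\<lambda>z. 2 * ?\<phi> \<delta> * D / real (k + 1) * ((ln (z * \<delta>) / ln z) ^ (k + 1) - ln a ^ (k + 1) / ln z ^ (k + 1)))
     \<longlongrightarrow> 2 * ?\<phi> \<delta> * D / real (k + 1) * (1 ^ (k + 1) - 0)) at_top"
    by (intro tendsto_intros lim1 tendsto_divide_0[OF tendsto_const]
        filterlim_at_top_imp_at_infinity filterlim_pow_at_top ln_at_top) auto
  then have "\<forall>\<^sub>F z in at_top. b < 2 * ?\<phi> \<delta> * D / real (k + 1) * ((ln (z * \<delta>) / ln z) ^ (k + 1) - ln a ^ (k + 1) / ln z ^ (k + 1))"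
    using \<delta> by (intro order_tendstoD(1)) auto
  with eventually_ge_at_top[of "a / \<delta>"] eventually_gt_at_top[of 1]
  show "\<forall>\<^sub>F z in at_top. b < (\<integral>y. ?\<phi> y * T (z * \<bar>y\<bar>) \<partial>lborel) * z / ln z ^ (k + 1)"
  proof eventually_elim
    case (elim z)
    have ln: "0 < ln z" using elim by simp
    note elim(3)
    also have "2 * ?\<phi> \<delta> * D / real (k + 1) * ((ln (z * \<delta>) / ln z) ^ (k + 1) - ln a ^ (k + 1) / ln z ^ (k + 1)) =
      2 * ?\<phi> \<delta> * D / real (k + 1) * (ln (z * \<delta>) ^ (k + 1) - ln a ^ (k + 1)) / ln z ^ (k + 1)"
      by (simp add: power_divide diff_divide_distrib right_diff_distrib)
    also have "\<dots> \<le> (\<integral>y. ?\<phi> y * T (z * \<bar>y\<bar>) \<partial>lborel) * z / ln z ^ (k + 1)"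
      using ln assms D elim a \<delta> by (intro divide_right_mono integral_ge_of_log_power_bound Tge) (auto simp: field_simps)
    finally show ?case .
  qed
qed

text \<open>For fixed \<open>x \<noteq> 0\<close>, \<open>ln (z / \<bar>x\<bar>) \<sim> ln z\<close>
  gives the pointwise limit \<open>C * \<bar>x\<bar>\<close> of the rescaled tail. Dominated
  convergence then yields \<open>C\<close> times the first absolute moment
  \<open>s * sqrt (2 / pi)\<close>.\<close>

lemma log_power_tail_mult_normal:
  assumes T: "((\<lambda>u. T u * u / ln u ^ k) \<longlongrightarrow> C) at_top" and "0 < C" "0 < s"
  shows "((\<lambda>z. (\<integral>x. normal_density 0 s x * T (z / \<bar>x\<bar>) \<partial>lborel) * z / ln z ^ k) \<longlongrightarrow>
    C * (s * sqrt (2 / pi))) at_top"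
proof -
  let ?\<phi> = "normal_density 0 s"
  have abs_moment: "has_bochner_integral lborel (\<lambda>x. ?\<phi> x * \<bar>x\<bar>) (s * sqrt (2 / pi))"
    using normal_moment_abs_odd[OF \<open>0 < s\<close>, of 0 0] by simp
  \<comment> \<open>Any constant above \<open>C\<close> would do, because \<open>D\<close> enters
    only the dominating function.\<close>
  define D where "D = C + 1"
  have "C < D" by (simp add: D_def)
  from order_tendstoD(2)[OF T this]
  obtain a0 where a0: "\<And>u. a0 \<le> u \<Longrightarrow> T u * u / ln u ^ k < D"
    by (auto simp: eventually_at_top_linorder)
  \<comment> \<open>The floor \<open>exp 1\<close> gives \<open>ln z \<ge> 1\<close>, so dividing by
    \<open>ln z ^ k\<close> never enlarges a nonnegative quantity.\<close>
  define a where "a = max a0 (exp 1)"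
  have a: "1 < a" by (simp add: a_def less_max_iff_disj)
  have D: "0 < D" using \<open>0 < C\<close> by (simp add: D_def)
  have Tle: "T u \<le> D * (ln u ^ k / u)" if "a \<le> u" for u
  proof -
    have "0 < u" "0 < ln u ^ k" using that a by (auto intro!: zero_less_power)
    then show ?thesis using a0[of u] that by (simp add: a_def field_simps)
  qed
  \<comment> \<open>A bound uniform in \<open>z\<close> and of linear growth in
    \<open>\<bar>x\<bar>\<close>, hence integrable against the density. Small
    \<open>\<bar>x\<bar>\<close> is handled by monotonicity, intermediate values by the tail bound,
    and large ones by \<open>T \<le> 1\<close> together with
    \<open>z < a * \<bar>x\<bar>\<close>.\<close>
  have bound: "T (z / \<bar>x\<bar>) * z / ln z ^ k \<le> D + (D + a) * \<bar>x\<bar>" if "a \<le> z" "x \<noteq> 0" for x z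
  proof -
    have "exp 1 \<le> z" using that by (simp add: a_def)
    then have ln: "1 \<le> ln z" and z: "0 < z"
      using that a by (auto simp: ln_ge_iff)
    have lnk: "1 \<le> ln z ^ k" using ln by simp
    consider "\<bar>x\<bar> \<le> 1" | "1 \<le> \<bar>x\<bar>" "a \<le> z / \<bar>x\<bar>" | "z / \<bar>x\<bar> < a" by linarith
    then show ?thesis
    proof cases
      case 1
      then have "z \<le> z / \<bar>x\<bar>" using that z by (simp add: field_simps)
      then have "T (z / \<bar>x\<bar>) \<le> D * (ln z ^ k / z)"
        using antimonoD[OF antimono] Tle[OF that(1)] by (blast intro: order_trans)
      then have "T (z / \<bar>x\<bar>) * z / ln z ^ k \<le> D" using z lnk by (simp add: field_simps)
      moreover have "0 \<le> (D + a) * \<bar>x\<bar>" using D a by simp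
      ultimately show ?thesis by linarith
    next
      case 2
      have "ln (z / \<bar>x\<bar>) ^ k \<le> ln z ^ k"
      proof (intro power_mono)
        have 1: "1 \<le> z / \<bar>x\<bar>" using 2 a by linarith
        have "z / \<bar>x\<bar> \<le> z" using 2 z by (auto simp: divide_le_eq)
        with 1 show "ln (z / \<bar>x\<bar>) \<le> ln z" by (intro ln_mono) linarith+
        show "0 \<le> ln (z / \<bar>x\<bar>)" using 1 by (rule ln_ge_zero)
      qed
      then have "D * (ln (z / \<bar>x\<bar>) ^ k / (z / \<bar>x\<bar>)) \<le> D * (ln z ^ k / (z / \<bar>x\<bar>))"
        using D z by (intro mult_left_mono divide_right_mono) auto
      with Tle[OF 2(2)] have "T (z / \<bar>x\<bar>) \<le> D * (ln z ^ k / (z / \<bar>x\<bar>))" by linarith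
      then have "T (z / \<bar>x\<bar>) * z / ln z ^ k \<le> D * \<bar>x\<bar>" using z lnk by (simp add: field_simps)
      moreover have "D * \<bar>x\<bar> \<le> (D + a) * \<bar>x\<bar>" using a by (intro mult_right_mono) auto
      ultimately show ?thesis using D by linarith
    next
      case 3
      have "T (z / \<bar>x\<bar>) * z \<le> z" using z le_1 by (simp add: mult_left_le_one_le nonneg)
      then have "T (z / \<bar>x\<bar>) * z / ln z ^ k \<le> z / ln z ^ k" using lnk by (intro divide_right_mono) auto
      also have "\<dots> \<le> z" using lnk z by (simp add: divide_le_eq)
      also have "\<dots> \<le> a * \<bar>x\<bar>" using 3 that by (simp add: field_simps)
      also have "\<dots> \<le> (D + a) * \<bar>x\<bar>" using D by (intro mult_right_mono) auto
      finally show ?thesis using D by linarith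
    qed
  qed
  have "((\<lambda>z. \<integral>x. ?\<phi> x * (T (z / \<bar>x\<bar>) * z / ln z ^ k) \<partial>lborel) \<longlongrightarrow> (\<integral>x. ?\<phi> x * (C * \<bar>x\<bar>) \<partial>lborel)) at_top"
  proof (rule integral_dominated_convergence_at_top[where w = "\<lambda>x. ?\<phi> x * (D + (D + a) * \<bar>x\<bar>)"])
    have "integrable lborel (\<lambda>x. ?\<phi> x * D + (?\<phi> x * \<bar>x\<bar>) * (D + a))"
      using abs_moment \<open>0 < s\<close>
      by (intro Bochner_Integration.integrable_add integrable_mult_left integrable_normal_density integrable.intros)
    then show "integrable lborel (\<lambda>x. ?\<phi> x * (D + (D + a) * \<bar>x\<bar>))"
      by (simp add: algebra_simps)
    \<comment> \<open>At \<open>x = 0\<close> the quotient \<open>z / \<bar>x\<bar>\<close> is 0 by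
      convention and the bound fails for large \<open>z\<close>; that point is a null set.\<close>
    have AE0: "AE x in lborel. x \<noteq> (0::real)" by (rule AE_lborel_singleton)
    show "AE x in lborel. ((\<lambda>z. ?\<phi> x * (T (z / \<bar>x\<bar>) * z / ln z ^ k)) \<longlongrightarrow> ?\<phi> x * (C * \<bar>x\<bar>)) at_top"
      using AE0
    proof eventually_elim
      case (elim x)
      have lim: "((\<lambda>z. ln (z / \<bar>x\<bar>) / ln z) \<longlongrightarrow> 1) at_top"
        using elim by real_asymp
      have top: "filterlim (\<lambda>z. z / \<bar>x\<bar>) at_top at_top" using elim by real_asymp
      have "((\<lambda>z. ?\<phi> x * ((T (z / \<bar>x\<bar>) * (z / \<bar>x\<bar>) / ln (z / \<bar>x\<bar>) ^ k) * (ln (z / \<bar>x\<bar>) / ln z) ^ k * \<bar>x\<bar>)) \<longlongrightarrow>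
          ?\<phi> x * (C * 1 ^ k * \<bar>x\<bar>)) at_top"
        by (intro tendsto_intros lim filterlim_compose[OF T top])
      moreover have "\<forall>\<^sub>F z in at_top. ?\<phi> x * ((T (z / \<bar>x\<bar>) * (z / \<bar>x\<bar>) / ln (z / \<bar>x\<bar>) ^ k) * (ln (z / \<bar>x\<bar>) / ln z) ^ k * \<bar>x\<bar>)
          = ?\<phi> x * (T (z / \<bar>x\<bar>) * z / ln z ^ k)"
        using eventually_gt_at_top[of 1] eventually_gt_at_top[of "\<bar>x\<bar>"]
      proof eventually_elim
        case (elim z)
        then have "ln (z / \<bar>x\<bar>) > 0" using \<open>x \<noteq> 0\<close> by simp
        then show ?case using \<open>x \<noteq> 0\<close> by (simp add: power_divide)
      qed
      ultimately have "((\<lambda>z. ?\<phi> x * (T (z / \<bar>x\<bar>) * z / ln z ^ k)) \<longlongrightarrow> ?\<phi> x * (C * 1 ^ k * \<bar>x\<bar>)) at_top"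
        by (rule Lim_transform_eventually)
      then show ?case by simp
    qed
    show "\<forall>\<^sub>F z in at_top. AE x in lborel. norm (?\<phi> x * (T (z / \<bar>x\<bar>) * z / ln z ^ k)) \<le> ?\<phi> x * (D + (D + a) * \<bar>x\<bar>)"
      using eventually_ge_at_top[of a]
    proof eventually_elim
      case (elim z)
      have z: "0 \<le> z" "0 \<le> ln z ^ k" using elim a by auto
      show ?case
        using AE0
      proof eventually_elim
        case x: (elim x)
        have "norm (?\<phi> x * (T (z / \<bar>x\<bar>) * z / ln z ^ k)) = ?\<phi> x * (T (z / \<bar>x\<bar>) * z / ln z ^ k)"
          using z by (simp add: abs_mult nonneg)
        also have "\<dots> \<le> ?\<phi> x * (D + (D + a) * \<bar>x\<bar>)"
          using elim x by (intro mult_left_mono bound) auto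
        finally show ?case .
      qed
    qed
  qed auto
  moreover have "(\<integral>x. ?\<phi> x * (C * \<bar>x\<bar>) \<partial>lborel) = C * (s * sqrt (2 / pi))"
    using has_bochner_integral_mult_right[OF abs_moment, of C]
    by (simp add: has_bochner_integral_iff mult_ac)
  moreover have "(\<integral>x. ?\<phi> x * (T (z / \<bar>x\<bar>) * z / ln z ^ k) \<partial>lborel) =
      (\<integral>x. ?\<phi> x * T (z / \<bar>x\<bar>) \<partial>lborel) * z / ln z ^ k" for z
    using integral_mult_left_zero[of lborel "\<lambda>x. ?\<phi> x * T (z / \<bar>x\<bar>)" "z / ln z ^ k"]
    by (simp add: mult.assoc)
  ultimately show ?thesis by (simp only:)
qed

end

context prob_space
begin

subsection \<open>Tails of products and quotients\<close>

text \<open>The inequality is non-strict to match \<open>cdf\<close> at \<open>- z\<close>, so that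
  for a symmetric variable and \<open>z > 0\<close> the tail is exactly twice the distribution
  function.\<close>

definition abs_tail :: "('a \<Rightarrow> real) \<Rightarrow> real \<Rightarrow> real" where
  "abs_tail U z = prob {\<omega> \<in> space M. z \<le> \<bar>U \<omega>\<bar>}"

lemma tail_function_abs_tail:
  assumes [measurable]: "random_variable borel U"
  shows "tail_function (abs_tail U)"
proof
  show "antimono (abs_tail U)"
    unfolding abs_tail_def by (intro antimonoI finite_measure_mono) auto
qed (simp_all add: abs_tail_def)

text \<open>Fubini for the product law of \<open>(W, U)\<close>: given \<open>W = w\<close>, the
  event becomes \<open>z / \<bar>g w\<bar> \<le> \<bar>U\<bar>\<close>. The function
  \<open>g\<close> lets one statement serve multiplication (identity) and division
  (\<open>inverse\<close>).\<close>

lemma abs_tail_mult_indep: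
  assumes indep: "indep_var borel W borel U"
    and W: "distributed M lborel W f" and f: "\<And>w. 0 \<le> f w" 
    and [measurable]: "g \<in> borel_measurable borel" "f \<in> borel_measurable borel"
    and g: "\<And>w. w \<noteq> 0 \<Longrightarrow> g w \<noteq> 0"
    and z: "0 < z"
  shows "abs_tail (\<lambda>\<omega>. g (W \<omega>) * U \<omega>) z = (\<integral>w. f w * abs_tail U (z / \<bar>g w\<bar>) \<partial>lborel)"
proof -
  note rv [measurable] = indep_var_rv1[OF indep] indep_var_rv2[OF indep]
  interpret T: tail_function "abs_tail U" by (rule tail_function_abs_tail) fact
  interpret U: prob_space "distr M borel U" by (rule prob_space_distr) fact
  define A where "A = {x. z \<le> \<bar>g (fst x) * snd x\<bar>}"
  have A [measurable]: "A \<in> sets (borel \<Otimes>\<^sub>M borel)" 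
  proof -
    have "A = {x \<in> space (borel \<Otimes>\<^sub>M borel). z \<le> \<bar>g (fst x) * snd x\<bar>}"
      by (simp add: A_def space_pair_measure)
    also have "\<dots> \<in> sets (borel \<Otimes>\<^sub>M borel)" by measurable
    finally show ?thesis .
  qed
  have sect: "emeasure (distr M borel U) (Pair w -` A) = ennreal (abs_tail U (z / \<bar>g w\<bar>))" if "w \<noteq> 0" for w
  proof -
    have "0 < \<bar>g w\<bar>" using g[OF that] by simp
    then have "Pair w -` A = {u. z / \<bar>g w\<bar> \<le> \<bar>u\<bar>}"
      by (auto simp: A_def abs_mult field_simps)
    moreover have "{u. z / \<bar>g w\<bar> \<le> \<bar>u\<bar>} \<in> sets borel" by measurable
    ultimately show ?thesis
      by (simp add: emeasure_distr abs_tail_def emeasure_eq_measure vimage_def Int_def conj_commute)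
  qed
  have "ennreal (abs_tail (\<lambda>\<omega>. g (W \<omega>) * U \<omega>) z) =
      emeasure (distr M (borel \<Otimes>\<^sub>M borel) (\<lambda>\<omega>. (W \<omega>, U \<omega>))) A"
  proof (subst emeasure_distr[OF _ A])
    have "{\<omega> \<in> space M. z \<le> \<bar>g (W \<omega>) * U \<omega>\<bar>} = (\<lambda>\<omega>. (W \<omega>, U \<omega>)) -` A \<inter> space M"
      by (auto simp: A_def)
    then show "ennreal (abs_tail (\<lambda>\<omega>. g (W \<omega>) * U \<omega>) z) = emeasure M ((\<lambda>\<omega>. (W \<omega>, U \<omega>)) -` A \<inter> space M)"
      by (simp add: abs_tail_def emeasure_eq_measure)
  qed simp
  also have "\<dots> = emeasure (distr M borel W \<Otimes>\<^sub>M distr M borel U) A"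
    using indep by (simp add: indep_var_distribution_eq)
  also have "\<dots> = (\<integral>\<^sup>+w. emeasure (distr M borel U) (Pair w -` A) \<partial>distr M borel W)"
    by (rule U.emeasure_pair_measure_alt) (simp add: A cong: sets_pair_measure_cong)
  also have "distr M borel W = density lborel f"
    using distributed_distr_eq_density[OF W] by (simp cong: distr_cong)
  also have "(\<integral>\<^sup>+w. emeasure (distr M borel U) (Pair w -` A) \<partial>density lborel f) =
      (\<integral>\<^sup>+w. f w * emeasure (distr M borel U) (Pair w -` A) \<partial>lborel)"
    by (rule nn_integral_density) (auto intro!: U.measurable_emeasure_Pair simp: A cong: sets_pair_measure_cong)
  also have "\<dots> = (\<integral>\<^sup>+w. ennreal (f w * abs_tail U (z / \<bar>g w\<bar>)) \<partial>lborel)"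
    \<comment> \<open>The slices were computed for \<open>w \<noteq> 0\<close> only; the remaining
      point is a null set.\<close>
    using AE_lborel_singleton[of "0::real"]
    by (intro nn_integral_cong_AE, eventually_elim) (simp add: sect ennreal_mult f T.nonneg)
  also have "\<dots> = ennreal (\<integral>w. f w * abs_tail U (z / \<bar>g w\<bar>) \<partial>lborel)"
  proof (rule nn_integral_eq_integral)
    have "integrable lborel f"
      using distributed_integrable[OF W, of "\<lambda>_. 1"] f by simp
    then show "integrable lborel (\<lambda>w. f w * abs_tail U (z / \<bar>g w\<bar>))"
      by (rule Bochner_Integration.integrable_bound)
        (auto simp: abs_mult f T.nonneg T.le_1 intro!: mult_left_le)
  qed (simp add: f T.nonneg)
  finally show ?thesis
    by (subst (asm) ennreal_inj) (auto simp: abs_tail_def f intro!: integral_nonneg_AE mult_nonneg_nonneg)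
qed

text \<open>Positivity of \<open>C\<close> is bundled in so that inductions carry it along: the
  limits for mixtures and the inversion of the tail both require it.\<close>

definition log_power_tail :: "('a \<Rightarrow> real) \<Rightarrow> nat \<Rightarrow> real \<Rightarrow> bool" where
  "log_power_tail U k C \<longleftrightarrow> 0 < C \<and> ((\<lambda>z. abs_tail U z * z / ln z ^ k) \<longlongrightarrow> C) at_top"

lemma log_power_tail_mult_inverse_normal:
  assumes tail: "log_power_tail U k C"
    and indep: "indep_var borel Y borel U"
    and Y: "distributed M lborel Y (normal_density 0 s)" "0 < s"
  shows "log_power_tail (\<lambda>\<omega>. inverse (Y \<omega>) * U \<omega>) (k + 1) (2 * normal_density 0 s 0 * C / real (k + 1))"
proof -
  interpret T: tail_function "abs_tail U"
    using indep_var_rv2[OF indep] by (rule tail_function_abs_tail)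
  have "\<forall>\<^sub>F z in at_top. (\<integral>y. normal_density 0 s y * abs_tail U (z * \<bar>y\<bar>) \<partial>lborel) * z / ln z ^ (k + 1)
      = abs_tail (\<lambda>\<omega>. inverse (Y \<omega>) * U \<omega>) z * z / ln z ^ (k + 1)"
    using eventually_gt_at_top[of 0]
    \<comment> \<open>The identity \<open>z / \<bar>inverse y\<bar> = z * \<bar>y\<bar>\<close>
      holds at \<open>y = 0\<close> too, where both sides are 0.\<close>
    by eventually_elim (subst abs_tail_mult_indep[OF indep Y(1)], auto simp: abs_inverse divide_inverse)
  from Lim_transform_eventually[OF T.log_power_tail_divide_normal[OF _ _ Y(2)] this]
  show ?thesis
    using tail normal_density_pos[OF Y(2), of 0 0] unfolding log_power_tail_def by auto
qed

lemma log_power_tail_mult_normal: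
  assumes tail: "log_power_tail U k C"
    and indep: "indep_var borel X borel U"
    and X: "distributed M lborel X (normal_density 0 s)" "0 < s"
  shows "log_power_tail (\<lambda>\<omega>. X \<omega> * U \<omega>) k (C * (s * sqrt (2 / pi)))"
proof -
  interpret T: tail_function "abs_tail U"
    using indep_var_rv2[OF indep] by (rule tail_function_abs_tail)
  have "\<forall>\<^sub>F z in at_top. (\<integral>y. normal_density 0 s y * abs_tail U (z / \<bar>y\<bar>) \<partial>lborel) * z / ln z ^ k
      = abs_tail (\<lambda>\<omega>. X \<omega> * U \<omega>) z * z / ln z ^ k"
    using eventually_gt_at_top[of 0]
    by eventually_elim (subst abs_tail_mult_indep[OF indep X(1), where g = "\<lambda>x. x"], auto)
  from Lim_transform_eventually[OF T.log_power_tail_mult_normal[OF _ _ X(2)] this]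
  show ?thesis
    using tail X(2) unfolding log_power_tail_def by auto
qed

section \<open>Tail constants of products, by induction on the factors\<close>

lemma prob_distributed_eq_integral:
  assumes "distributed M lborel W f" "\<And>w. 0 \<le> f w" "A \<in> sets borel"
  shows "prob (W -` A \<inter> space M) = (\<integral>w. f w * indicator A w \<partial>lborel)"
proof -
  have [measurable]: "W \<in> borel_measurable M"
    using distributed_measurable[OF assms(1)] by simp
  have "(\<integral>w. f w * indicator A w \<partial>lborel) = (\<integral>\<omega>. indicator A (W \<omega>) \<partial>M)"
    using assms by (intro distributed_integral) auto
  also have "\<dots> = (\<integral>\<omega>. indicator (W -` A \<inter> space M) \<omega> \<partial>M)"
    by (intro Bochner_Integration.integral_cong) (auto simp: indicator_def)
  finally show ?thesis using assms(3) by simp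
qed

text \<open>The event says that \<open>Y\<close> is nonzero and within \<open>1 / z\<close> of 0, an
  interval of length \<open>2 / z\<close> on which the density lies between its values at
  \<open>1 / z\<close> and at 0. The induction has to start here, since the empty product 1 has no
  tail of this kind.\<close>

lemma log_power_tail_inverse_normal:
  assumes Y: "distributed M lborel Y (normal_density 0 s)" "0 < s"
  shows "log_power_tail (\<lambda>\<omega>. inverse (Y \<omega>)) 0 (2 * normal_density 0 s 0)"
proof -
  let ?\<phi> = "normal_density 0 s"
  have [measurable]: "Y \<in> borel_measurable M"
    using distributed_measurable[OF Y(1)] by simp
  have bounds: "abs_tail (\<lambda>\<omega>. inverse (Y \<omega>)) z * z \<in> {2 * ?\<phi> (1 / z)..2 * ?\<phi> 0}" if z: "0 < z" for z
  proof -
    \<comment> \<open>The point 0 is removed because \<open>inverse 0 = 0\<close>.\<close>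
    let ?A = "{-(1/z)..1/z} - {0}"
    have mem: "z \<le> \<bar>inverse y\<bar> \<longleftrightarrow> y \<in> ?A" for y
    proof (cases "y = 0")
      case False
      then have "z \<le> \<bar>inverse y\<bar> \<longleftrightarrow> \<bar>y\<bar> \<le> 1 / z" using z by (simp add: abs_inverse field_simps)
      then show ?thesis using False by auto
    qed (use z in simp)
    have "abs_tail (\<lambda>\<omega>. inverse (Y \<omega>)) z = prob (Y -` ?A \<inter> space M)"
      unfolding abs_tail_def mem by (rule arg_cong[where f = prob]) blast
    also have "\<dots> = (\<integral>y. ?\<phi> y * indicator ?A y \<partial>lborel)"
      using Y by (intro prob_distributed_eq_integral) auto
    also have "\<dots> = (\<integral>y. ?\<phi> y * indicator {-(1/z)..1/z} y \<partial>lborel)"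
      using AE_lborel_singleton[of "0::real"]
      by (intro integral_cong_AE, simp, simp, eventually_elim) (auto simp: indicator_def)
    finally have eq: "abs_tail (\<lambda>\<omega>. inverse (Y \<omega>)) z = \<dots>" .
    have int: "integrable lborel (\<lambda>y. c * indicator {-(1/z)..1/z} y)" for c :: real
      by (intro integrable_mult_right integrable_real_indicator) (auto simp: emeasure_lborel_Icc_eq)
    have val: "(\<integral>y. c * indicator {-(1/z)..1/z} y \<partial>lborel) = c * (2 / z)" for c :: real
      using z by simp
    have int2: "integrable lborel (\<lambda>y. ?\<phi> y * indicator {-(1/z)..1/z} y)"
      using Y by (intro integrable_real_mult_indicator integrable_normal_density) auto
    have "?\<phi> (1 / z) * (2 / z) \<le> abs_tail (\<lambda>\<omega>. inverse (Y \<omega>)) z"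
      unfolding eq val[symmetric] using Y z
      by (intro integral_mono int int2) (auto simp: indicator_def intro!: normal_density_antimono_abs)
    moreover have "abs_tail (\<lambda>\<omega>. inverse (Y \<omega>)) z \<le> ?\<phi> 0 * (2 / z)"
      unfolding eq val[symmetric] using Y
      by (intro integral_mono int int2) (auto simp: indicator_def intro!: normal_density_antimono_abs)
    ultimately show ?thesis using z by (simp add: field_simps)
  qed
  have "((\<lambda>z. abs_tail (\<lambda>\<omega>. inverse (Y \<omega>)) z * z) \<longlongrightarrow> 2 * ?\<phi> 0) at_top"
  proof (rule tendsto_sandwich[where f = "\<lambda>z. 2 * ?\<phi> (1 / z)" and h = "\<lambda>_. 2 * ?\<phi> 0"])
    have "((\<lambda>z::real. 1 / z) \<longlongrightarrow> 0) at_top" by real_asymp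
    then show "((\<lambda>z. 2 * ?\<phi> (1 / z)) \<longlongrightarrow> 2 * ?\<phi> 0) at_top"
      unfolding normal_density_def using Y by (intro tendsto_intros) auto
  qed (use bounds in \<open>auto intro: eventually_mono[OF eventually_gt_at_top[of 0]]\<close>)
  then show ?thesis
    using normal_density_pos[OF Y(2)] by (simp add: log_power_tail_def)
qed

text \<open>Adding a factor to \<open>card J\<close> earlier ones raises the exponent from
  \<open>card J - 1\<close> to \<open>card J\<close> and divides the constant by
  \<open>card J\<close>; these divisors accumulate to the factorial.\<close>

lemma log_power_tail_prod_inverse_normal:
  fixes Y :: "'i \<Rightarrow> 'a \<Rightarrow> real" and s :: "'i \<Rightarrow> real"
  assumes "finite J" "J \<noteq> {}"
    and "\<And>j. j \<in> J \<Longrightarrow> 0 < s j"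
    and "\<And>j. j \<in> J \<Longrightarrow> distributed M lborel (Y j) (normal_density 0 (s j))"
    and "indep_vars (\<lambda>_. borel) Y J"
  shows "log_power_tail (\<lambda>\<omega>. \<Prod>j\<in>J. inverse (Y j \<omega>)) (card J - 1)
    ((\<Prod>j\<in>J. 2 * normal_density 0 (s j) 0) / fact (card J - 1))"
  using assms
proof (induction J rule: finite_ne_induct)
  case (singleton j)
  then show ?case using log_power_tail_inverse_normal[of "Y j" "s j"] by simp
next
  case (insert j J)
  let ?C = "(\<Prod>j\<in>J. 2 * normal_density 0 (s j) 0) / fact (card J - 1)"
  \<comment> \<open>All coordinates but \<open>j\<close> are inverted, so that a single independent
    family provides both \<open>Y j\<close> and the product of the other inverses.\<close>
  have "indep_vars (\<lambda>_. borel) (\<lambda>i \<omega>. (if i = j then (\<lambda>y. y) else inverse) (Y i \<omega>)) (insert j J)"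
    using insert.prems(3) by (rule indep_vars_compose2) auto
  note indep_vars_prod[OF insert.hyps(1,3) this]
  also have "(\<lambda>\<omega>. \<Prod>i\<in>J. (if i = j then (\<lambda>y. y) else inverse) (Y i \<omega>)) = (\<lambda>\<omega>. \<Prod>i\<in>J. inverse (Y i \<omega>))"
    using insert.hyps(3) by (intro ext prod.cong) auto
  finally have indep: "indep_var borel (Y j) borel (\<lambda>\<omega>. \<Prod>j\<in>J. inverse (Y j \<omega>))" by simp
  have "log_power_tail (\<lambda>\<omega>. \<Prod>j\<in>J. inverse (Y j \<omega>)) (card J - 1) ?C"
    using insert.prems by (intro insert.IH) (auto intro: indep_vars_subset)
  from log_power_tail_mult_inverse_normal[OF this indep, of "s j"]
  have "log_power_tail (\<lambda>\<omega>. inverse (Y j \<omega>) * (\<Prod>j\<in>J. inverse (Y j \<omega>))) (card J - 1 + 1)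
     (2 * normal_density 0 (s j) 0 * ?C / real (card J - 1 + 1))"
    using insert.prems by simp
  \<comment> \<open>This resolves the truncated subtraction in
    \<open>card J - 1 + 1\<close>.\<close>
  moreover obtain n where "card J = Suc n"
    using insert.hyps by (cases "card J") auto
  ultimately show ?case using insert.hyps by (simp add: field_simps)
qed

text \<open>Each new factor contributes its first absolute moment and leaves \<open>k\<close>
  unchanged; \<open>J\<close> stays fixed while \<open>I\<close> grows.\<close>

lemma log_power_tail_prod_normal:
  fixes V :: "'i \<Rightarrow> 'a \<Rightarrow> real" and s :: "'i \<Rightarrow> real"
  assumes "finite I" "finite J" "I \<inter> J = {}"
    and tail: "log_power_tail (\<lambda>\<omega>. \<Prod>j\<in>J. V j \<omega>) k C"
    and "\<And>i. i \<in> I \<Longrightarrow> 0 < s i"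
    and "\<And>i. i \<in> I \<Longrightarrow> distributed M lborel (V i) (normal_density 0 (s i))"
    and "indep_vars (\<lambda>_. borel) V (I \<union> J)"
  shows "log_power_tail (\<lambda>\<omega>. \<Prod>i\<in>I \<union> J. V i \<omega>) k (C * (\<Prod>i\<in>I. s i * sqrt (2 / pi)))"
  using assms(1,3,5-)
proof (induction I rule: finite_induct)
  case empty
  then show ?case using tail by simp
next
  case (insert i I)
  let ?C = "C * (\<Prod>i\<in>I. s i * sqrt (2 / pi))"
  have fin: "finite (I \<union> J)" and i: "i \<notin> I \<union> J" using insert assms(2) by auto
  have indep: "indep_var borel (V i) borel (\<lambda>\<omega>. \<Prod>i\<in>I \<union> J. V i \<omega>)"
    using insert.prems by (intro indep_vars_prod fin i) auto
  have "log_power_tail (\<lambda>\<omega>. \<Prod>i\<in>I \<union> J. V i \<omega>) k ?C"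
    using insert.prems by (intro insert.IH) (auto intro: indep_vars_subset)
  from log_power_tail_mult_normal[OF this indep, of "s i"]
  show ?case using insert.prems insert.hyps i fin by (simp add: mult_ac)
qed

text \<open>By independence \<open>(W, U)\<close> and \<open>(- W, U)\<close> have the same joint
  law, so oddness of \<open>g\<close> makes \<open>g W * U\<close> symmetric. For
  \<open>z > 0\<close> the two one-sided events are disjoint and share the two-sided tail
  equally.\<close>

lemma prob_le_eq_half_abs_tail:
  assumes indep: "indep_var borel W borel U"
    and W: "distributed M lborel W (normal_density 0 s)" "0 < s"
    and g [measurable]: "g \<in> borel_measurable borel" and odd: "\<And>w. g (- w) = - g w"
    and z: "0 < z"
  shows "prob {\<omega> \<in> space M. g (W \<omega>) * U \<omega> \<le> - z} = abs_tail (\<lambda>\<omega>. g (W \<omega>) * U \<omega>) z / 2"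
proof -
  note rv [measurable] = indep_var_rv1[OF indep] indep_var_rv2[OF indep]
  have indep': "indep_var borel (\<lambda>\<omega>. - W \<omega>) borel U"
    using indep_var_compose[OF indep, of uminus borel "\<lambda>x. x" borel] by (simp add: comp_def)
  have W': "distributed M lborel (\<lambda>\<omega>. - W \<omega>) (normal_density 0 s)"
    using normal_density_affine[OF W, of "-1" 0] by simp
  have "distr M borel W = distr M lborel W" "distr M borel (\<lambda>\<omega>. - W \<omega>) = distr M lborel (\<lambda>\<omega>. - W \<omega>)"
    by (simp_all cong: distr_cong)
  then have "distr M borel W = distr M borel (\<lambda>\<omega>. - W \<omega>)"
    using distributed_distr_eq_density[OF W(1)] distributed_distr_eq_density[OF W'] by simp
  then have joint: "distr M (borel \<Otimes>\<^sub>M borel) (\<lambda>\<omega>. (W \<omega>, U \<omega>)) = distr M (borel \<Otimes>\<^sub>M borel) (\<lambda>\<omega>. (- W \<omega>, U \<omega>))"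
    using indep indep' by (simp add: indep_var_distribution_eq)
  define A where "A = {x \<in> space (borel \<Otimes>\<^sub>M borel). g (fst x) * snd x \<le> - z}"
  have A: "A \<in> sets (borel \<Otimes>\<^sub>M borel)" unfolding A_def by measurable
  have "prob {\<omega> \<in> space M. g (W \<omega>) * U \<omega> \<le> - z} = measure (distr M (borel \<Otimes>\<^sub>M borel) (\<lambda>\<omega>. (W \<omega>, U \<omega>))) A"
    by (subst measure_distr[OF _ A]) (auto simp: A_def space_pair_measure vimage_def Int_def conj_commute)
  also have "\<dots> = measure (distr M (borel \<Otimes>\<^sub>M borel) (\<lambda>\<omega>. (- W \<omega>, U \<omega>))) A"
    by (simp add: joint)
  also have "\<dots> = prob {\<omega> \<in> space M. z \<le> g (W \<omega>) * U \<omega>}"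
    by (subst measure_distr[OF _ A]) (auto simp: A_def odd space_pair_measure vimage_def Int_def conj_commute)
  finally have sym: "prob {\<omega> \<in> space M. g (W \<omega>) * U \<omega> \<le> - z} = prob {\<omega> \<in> space M. z \<le> g (W \<omega>) * U \<omega>}" .
  have "abs_tail (\<lambda>\<omega>. g (W \<omega>) * U \<omega>) z =
      prob ({\<omega> \<in> space M. g (W \<omega>) * U \<omega> \<le> - z} \<union> {\<omega> \<in> space M. z \<le> g (W \<omega>) * U \<omega>})"
    unfolding abs_tail_def by (intro arg_cong[where f = prob]) (auto simp: abs_real_def)
  also have "\<dots> = prob {\<omega> \<in> space M. g (W \<omega>) * U \<omega> \<le> - z} + prob {\<omega> \<in> space M. z \<le> g (W \<omega>) * U \<omega>}"
    using z by (intro finite_measure_Union) auto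
  finally show ?thesis using sym by simp
qed

section \<open>From the two-sided tail to the quantile of the quotient\<close>

lemma cdf_distr_eq_prob:
  assumes "random_variable borel Z"
  shows "cdf (distr M borel Z) z = prob {\<omega> \<in> space M. Z \<omega> \<le> z}"
  unfolding cdf_def using assms
  by (subst measure_distr) (auto intro!: arg_cong[where f = prob])

text \<open>The inverses of the denominators supply the initial tail, the numerators then rescale
  its constant, and symmetry halves it before the inversion.\<close>

lemma quantile_prod_div_prod_normal:
  fixes X Y :: "nat \<Rightarrow> 'a \<Rightarrow> real" and \<sigma>X \<sigma>Y :: "nat \<Rightarrow> real"
  assumes \<sigma>X: "\<And>i. i \<in> {1..m} \<Longrightarrow> \<sigma>X i > 0"
    and \<sigma>Y: "\<And>j. j \<in> {1..n} \<Longrightarrow> \<sigma>Y j > 0"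
    and X: "\<And>i. i \<in> {1..m} \<Longrightarrow> distributed M lborel (X i) (normal_density 0 (\<sigma>X i))"
    and Y: "\<And>j. j \<in> {1..n} \<Longrightarrow> distributed M lborel (Y j) (normal_density 0 (\<sigma>Y j))"
    and indep: "indep_vars (\<lambda>_. borel) (case_sum X Y) ({1..m} <+> {1..n})"
    and n: "1 \<le> n"
  shows "quantile (distr M borel (\<lambda>\<omega>. (\<Prod>i=1..m. X i \<omega>) / (\<Prod>j=1..n. Y j \<omega>))) \<sim>[at_right 0]
     (\<lambda>p. - (2 powr ((real m + real n - 2) / 2) * (\<Prod>i=1..m. \<sigma>X i)
                     / (pi powr ((real m + real n) / 2) * (\<Prod>j=1..n. \<sigma>Y j) * fact (n - 1))
                   * (ln (1 / p) ^ (n - 1) / p)))"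
proof -
  let ?I = "Inl ` {1..m} :: (nat + nat) set" and ?J = "Inr ` {1..n} :: (nat + nat) set"
  define V where "V = case_sum X (\<lambda>j \<omega>. inverse (Y j \<omega>))"
  define Z where "Z = (\<lambda>\<omega>. (\<Prod>i=1..m. X i \<omega>) / (\<Prod>j=1..n. Y j \<omega>))"
  have Z_eq: "Z \<omega> = (\<Prod>i\<in>?I \<union> ?J. V i \<omega>)" for \<omega>
    by (subst prod.union_disjoint)
      (auto simp: Z_def V_def prod.reindex divide_inverse prod_inversef[symmetric] comp_def)
  have indep_V: "indep_vars (\<lambda>_. borel) V (?I \<union> ?J)"
  proof -
    have "indep_vars (\<lambda>_. borel) (\<lambda>i \<omega>. case_sum (\<lambda>_ x. x) (\<lambda>_. inverse) i (case_sum X Y i \<omega>)) ({1..m} <+> {1..n})"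
      using indep by (rule indep_vars_compose2) (auto split: sum.split)
    also have "(\<lambda>i \<omega>. case_sum (\<lambda>_ x. x) (\<lambda>_. inverse) i (case_sum X Y i \<omega>)) = V"
      by (auto simp: V_def fun_eq_iff split: sum.split)
    finally show ?thesis by (simp add: Plus_def)
  qed
  have "indep_vars (\<lambda>_. borel) (case_sum X Y) ?J"
    using indep by (rule indep_vars_subset) (auto simp: Plus_def)
  moreover have "0 < case_sum \<sigma>X \<sigma>Y j"
    "distributed M lborel (case_sum X Y j) (normal_density 0 (case_sum \<sigma>X \<sigma>Y j))" if "j \<in> ?J" for j
    using that \<sigma>Y Y by auto
  ultimately have "log_power_tail (\<lambda>\<omega>. \<Prod>j\<in>?J. inverse (case_sum X Y j \<omega>)) (card ?J - 1)
      ((\<Prod>j\<in>?J. 2 * normal_density 0 (case_sum \<sigma>X \<sigma>Y j) 0) / fact (card ?J - 1))"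
    using n by (intro log_power_tail_prod_inverse_normal) auto
  then
  have "log_power_tail (\<lambda>\<omega>. \<Prod>j\<in>?J. V j \<omega>) (n - 1) ((\<Prod>j=1..n. 2 * normal_density 0 (\<sigma>Y j) 0) / fact (n - 1))"
    by (simp add: prod.reindex V_def card_image comp_def)
  moreover have "0 < case_sum \<sigma>X \<sigma>Y i"
    "distributed M lborel (V i) (normal_density 0 (case_sum \<sigma>X \<sigma>Y i))" if "i \<in> ?I" for i
    using that \<sigma>X X by (auto simp: V_def)
  ultimately have "log_power_tail (\<lambda>\<omega>. \<Prod>i\<in>?I \<union> ?J. V i \<omega>) (n - 1)
      ((\<Prod>j=1..n. 2 * normal_density 0 (\<sigma>Y j) 0) / fact (n - 1) *
      (\<Prod>i\<in>?I. case_sum \<sigma>X \<sigma>Y i * sqrt (2 / pi)))"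
    using indep_V by (intro log_power_tail_prod_normal) auto
  then have tail: "log_power_tail Z (n - 1) ((\<Prod>j=1..n. 2 * normal_density 0 (\<sigma>Y j) 0) / fact (n - 1) *
      (\<Prod>i=1..m. \<sigma>X i * sqrt (2 / pi)))" (is "log_power_tail _ _ ?C")
    by (simp add: prod.reindex comp_def Z_eq[abs_def])
  have Z_rv: "random_variable borel Z"
    using indep_V unfolding Z_eq[abs_def] by (intro borel_measurable_prod) (auto simp: indep_vars_def)
  define g where "g = (inverse :: real \<Rightarrow> real)"
  \<comment> \<open>One factor is split off to flip the sign of \<open>Z\<close>; \<open>Y 1\<close>
    is available because \<open>1 \<le> n\<close>.\<close>
  define U where "U = (\<lambda>\<omega>. \<Prod>i\<in>?I \<union> ?J - {Inr 1}. V i \<omega>)"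
  have Z_g: "Z \<omega> = g (Y 1 \<omega>) * U \<omega>" for \<omega>
    unfolding Z_eq U_def using n by (subst prod.remove[of _ "Inr 1"]) (auto simp: V_def g_def)
  have indep_Y: "indep_var borel (Y 1) borel U"
  proof -
    \<comment> \<open>Inverting coordinate \<open>Inr 1\<close> a second time recovers
      \<open>Y 1\<close> itself.\<close>
    have "indep_vars (\<lambda>_. borel) (\<lambda>i \<omega>. (if i = Inr 1 then inverse else (\<lambda>x. x)) (V i \<omega>)) (insert (Inr 1) (?I \<union> ?J - {Inr 1}))"
      using n by (intro indep_vars_compose2[OF indep_V[THEN indep_vars_subset]]) auto
    note indep_vars_prod[OF _ _ this]
    also have "(\<lambda>\<omega>. \<Prod>i\<in>?I \<union> ?J - {Inr 1}. (if i = Inr 1 then inverse else (\<lambda>x. x)) (V i \<omega>)) = U"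
      unfolding U_def by (intro ext prod.cong) auto
    finally show ?thesis by (simp add: V_def)
  qed
  have half: "cdf (distr M borel Z) (- z) = abs_tail Z z / 2" if "0 < z" for z
    using prob_le_eq_half_abs_tail[OF indep_Y Y \<sigma>Y, of g z] n that
    by (subst cdf_distr_eq_prob[OF Z_rv]) (auto simp: Z_g[abs_def] g_def)
  have "((\<lambda>z. abs_tail Z z * z / ln z ^ (n - 1) / 2) \<longlongrightarrow> ?C / 2) at_top"
    using tail unfolding log_power_tail_def by (intro tendsto_intros) auto
  moreover have "\<forall>\<^sub>F z in at_top. abs_tail Z z * z / ln z ^ (n - 1) / 2 = cdf (distr M borel Z) (- z) * z / ln z ^ (n - 1)"
    using eventually_gt_at_top[of 0] by eventually_elim (simp add: half)
  ultimately have "((\<lambda>z. cdf (distr M borel Z) (- z) * z / ln z ^ (n - 1)) \<longlongrightarrow> ?C / 2) at_top"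
    by (rule Lim_transform_eventually)
  moreover have "real_distribution (distr M borel Z)"
    using Z_rv by (rule real_distribution_distr)
  moreover have "0 < ?C / 2" using tail by (simp add: log_power_tail_def)
  ultimately have "quantile (distr M borel Z) \<sim>[at_right 0] (\<lambda>p. - (?C / 2 * (ln (1 / p) ^ (n - 1) / p)))"
    by (intro quantile_asymp_equiv_log_power_tail)
  also have "?C / 2 = 2 powr ((real m + real n - 2) / 2) * (\<Prod>i=1..m. \<sigma>X i)
                     / (pi powr ((real m + real n) / 2) * (\<Prod>j=1..n. \<sigma>Y j) * fact (n - 1))"
  proof -
    \<comment> \<open>Every factor contributes one \<open>r\<close>: a denominator gives
      \<open>r / \<sigma>Y j\<close>, a numerator \<open>\<sigma>X i * r\<close>.\<close>
    define r where "r = sqrt (2 / pi)"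
    have phi0: "2 * normal_density 0 (\<sigma>Y j) 0 = r / \<sigma>Y j" if "j \<in> {1..n}" for j
      using \<sigma>Y[OF that] by (simp add: normal_density_def r_def real_sqrt_mult real_sqrt_divide field_simps)
    have "r ^ (m + n) = (2 / pi) powr ((real m + real n) / 2)"
      by (simp add: r_def powr_half_sqrt[symmetric] powr_powr powr_realpow[symmetric] algebra_simps)
    \<comment> \<open>The factor 2 split off here cancels the halving due to symmetry.\<close>
    also have "\<dots> = 2 * 2 powr ((real m + real n - 2) / 2) / pi powr ((real m + real n) / 2)"
      by (simp add: powr_divide diff_divide_distrib powr_diff)
    finally have r: "r ^ (m + n) = \<dots>" .
    have "(\<Prod>j=1..n. 2 * normal_density 0 (\<sigma>Y j) 0) = r ^ n / (\<Prod>j=1..n. \<sigma>Y j)"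
      using prod.cong[OF refl phi0, of "{1..n}"] by (simp add: prod_dividef)
    moreover have "(\<Prod>i=1..m. \<sigma>X i * sqrt (2 / pi)) = (\<Prod>i=1..m. \<sigma>X i) * r ^ m"
      by (simp add: prod.distrib r_def)
    ultimately have "?C / 2 = (\<Prod>i=1..m. \<sigma>X i) * r ^ (m + n) / 2 / ((\<Prod>j=1..n. \<sigma>Y j) * fact (n - 1))"
      by (simp add: power_add mult_ac)
    then show ?thesis by (simp add: r mult_ac)
  qed
  finally show ?thesis by (simp add: Z_def)
qed

subsection \<open>Products of normal variables\<close>

text \<open>For \<open>\<theta> < 1 / 2\<close> the exponential weight turns the density into a
  multiple of a wider normal density, whose total mass is 1.\<close>

lemma nn_integral_exp_square_normal:
  assumes X: "distributed M lborel X (normal_density 0 s)" and s: "0 < s" and \<theta>: "\<theta> < 1 / 2"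
  shows "(\<integral>\<^sup>+\<omega>. ennreal (exp (\<theta> * (X \<omega> / s)\<^sup>2)) \<partial>M) = ennreal (1 / sqrt (1 - 2 * \<theta>))"
proof -
  \<comment> \<open>Both the factor by which the standard deviation widens and the resulting
    normalising constant.\<close>
  define c where "c = 1 / sqrt (1 - 2 * \<theta>)"
  have c: "0 < c" "c\<^sup>2 = 1 / (1 - 2 * \<theta>)" using \<theta> by (auto simp: c_def power_divide)
  have dens: "normal_density 0 s x * exp (\<theta> * (x / s)\<^sup>2) = c * normal_density 0 (s * c) x" for x
  proof -
    have "- x\<^sup>2 / (2 * s\<^sup>2) + \<theta> * (x / s)\<^sup>2 = - x\<^sup>2 / (2 * (s * c)\<^sup>2)"
      using s \<theta> by (simp add: power_mult_distrib c(2) power_divide field_simps)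
    then have "exp (- x\<^sup>2 / (2 * s\<^sup>2)) * exp (\<theta> * (x / s)\<^sup>2) = exp (- x\<^sup>2 / (2 * (s * c)\<^sup>2))"
      by (simp add: exp_add[symmetric])
    moreover have "1 / sqrt (2 * pi * s\<^sup>2) = c * (1 / sqrt (2 * pi * (s * c)\<^sup>2))"
      using s c(1) by (simp add: real_sqrt_mult power_mult_distrib)
    ultimately show ?thesis by (simp add: normal_density_def)
  qed
  have "(\<integral>\<^sup>+\<omega>. ennreal (exp (\<theta> * (X \<omega> / s)\<^sup>2)) \<partial>M) =
      (\<integral>\<^sup>+x. ennreal (normal_density 0 s x) * ennreal (exp (\<theta> * (x / s)\<^sup>2)) \<partial>lborel)"
    by (rule distributed_nn_integral[OF X, symmetric]) measurable
  also have "\<dots> = (\<integral>\<^sup>+x. ennreal c * ennreal (normal_density 0 (s * c) x) \<partial>lborel)"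
    using c by (intro nn_integral_cong) (simp add: ennreal_mult[symmetric] dens)
  also have "\<dots> = ennreal c * (\<integral>\<^sup>+x. ennreal (normal_density 0 (s * c) x) \<partial>lborel)"
    by (rule nn_integral_cmult) simp
  also have "(\<integral>\<^sup>+x. ennreal (normal_density 0 (s * c) x) \<partial>lborel) = 1"
    using s c by (subst nn_integral_eq_integral) auto
  finally show ?thesis by (simp add: c_def)
qed

text \<open>Squaring and the arithmetic-geometric mean inequality bound the sum of normalised
  squares from below on the event. An exponential Markov inequality, factorised by independence,
  does the rest.\<close>

lemma abs_tail_prod_normal_le:
  fixes X :: "'i \<Rightarrow> 'a \<Rightarrow> real"
  assumes I: "finite I" "I \<noteq> {}"
    and s: "\<And>i. i \<in> I \<Longrightarrow> 0 < s i"
    and X: "\<And>i. i \<in> I \<Longrightarrow> distributed M lborel (X i) (normal_density 0 (s i))"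
    and indep: "indep_vars (\<lambda>_. borel) X I"
    and \<theta>: "0 < \<theta>" "\<theta> < 1 / 2" and v: "0 < v"
  shows "abs_tail (\<lambda>\<omega>. \<Prod>i\<in>I. X i \<omega>) ((\<Prod>i\<in>I. s i) * v ^ card I) \<le>
    (1 / sqrt (1 - 2 * \<theta>)) ^ card I * exp (- (\<theta> * card I * v\<^sup>2))"
proof -
  have [measurable]: "X i \<in> borel_measurable M" if "i \<in> I" for i
    using distributed_measurable[OF X[OF that]] by simp
  let ?A = "{\<omega> \<in> space M. (\<Prod>i\<in>I. s i) * v ^ card I \<le> \<bar>\<Prod>i\<in>I. X i \<omega>\<bar>}"
  have n: "0 < card I" using I by (simp add: card_gt_0_iff)
  have A: "?A \<in> sets M" using I by measurable
  have bound: "1 \<le> exp (- (\<theta> * card I * v\<^sup>2)) * (\<Prod>i\<in>I. exp (\<theta> * (X i \<omega> / s i)\<^sup>2))" if "\<omega> \<in> ?A" for \<omega>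
  proof -
    have S: "0 < (\<Prod>i\<in>I. s i)" using s by (rule prod_pos)
    have "v ^ card I \<le> \<bar>\<Prod>i\<in>I. X i \<omega>\<bar> / (\<Prod>i\<in>I. s i)" using that S by (simp add: field_simps)
    then have "(v ^ card I)\<^sup>2 \<le> (\<bar>\<Prod>i\<in>I. X i \<omega>\<bar> / (\<Prod>i\<in>I. s i))\<^sup>2" using v by (intro power_mono) auto
    then have "(v\<^sup>2) ^ card I \<le> (\<Prod>i\<in>I. (X i \<omega> / s i)\<^sup>2)"
      by (simp add: power_divide prod_dividef prod_power_distrib power_mult[symmetric] mult.commute)
    then have "((v\<^sup>2) ^ card I) powr (1 / card I) \<le> (\<Prod>i\<in>I. (X i \<omega> / s i)\<^sup>2) powr (1 / card I)"
      by (intro powr_mono2) auto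
    also have "\<dots> \<le> (\<Sum>i\<in>I. (X i \<omega> / s i)\<^sup>2 / card I)"
      using I by (intro arith_geom_mean) auto
    also have "((v\<^sup>2) ^ card I) powr (1 / card I) = v\<^sup>2"
      using n v powr_realpow[of "v\<^sup>2" "card I", symmetric] by (simp add: powr_powr)
    finally have "v\<^sup>2 \<le> (\<Sum>i\<in>I. (X i \<omega> / s i)\<^sup>2) / card I"
      by (simp add: sum_divide_distrib)
    then have "\<theta> * (card I * v\<^sup>2) \<le> \<theta> * (\<Sum>i\<in>I. (X i \<omega> / s i)\<^sup>2)"
      using n \<theta> by (intro mult_left_mono) (auto simp: field_simps)
    then show ?thesis
      using I by (simp add: exp_sum[symmetric] exp_add[symmetric] sum_distrib_left[symmetric] mult.assoc)
  qed
  have "ennreal (prob ?A) = (\<integral>\<^sup>+\<omega>. indicator ?A \<omega> \<partial>M)"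
    using A by (simp add: emeasure_eq_measure)
  also have "\<dots> \<le> (\<integral>\<^sup>+\<omega>. ennreal (exp (- (\<theta> * card I * v\<^sup>2))) * (\<Prod>i\<in>I. ennreal (exp (\<theta> * (X i \<omega> / s i)\<^sup>2))) \<partial>M)"
    by (intro nn_integral_mono)
      (auto simp: indicator_def prod_ennreal ennreal_mult[symmetric] prod_nonneg ennreal_1[symmetric] simp del: ennreal_1 intro!: ennreal_leI bound)
  also have "\<dots> = ennreal (exp (- (\<theta> * card I * v\<^sup>2))) * (\<integral>\<^sup>+\<omega>. (\<Prod>i\<in>I. ennreal (exp (\<theta> * (X i \<omega> / s i)\<^sup>2))) \<partial>M)"
    by (rule nn_integral_cmult) measurable
  also have "(\<integral>\<^sup>+\<omega>. (\<Prod>i\<in>I. ennreal (exp (\<theta> * (X i \<omega> / s i)\<^sup>2))) \<partial>M) =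
      (\<Prod>i\<in>I. \<integral>\<^sup>+\<omega>. ennreal (exp (\<theta> * (X i \<omega> / s i)\<^sup>2)) \<partial>M)"
    using I by (intro indep_vars_nn_integral indep_vars_compose2[OF indep]) auto
  also have "\<dots> = (\<Prod>i\<in>I. ennreal (1 / sqrt (1 - 2 * \<theta>)))"
    using X s \<theta> by (intro prod.cong nn_integral_exp_square_normal) auto
  also have "ennreal (exp (- (\<theta> * card I * v\<^sup>2))) * \<dots> =
      ennreal ((1 / sqrt (1 - 2 * \<theta>)) ^ card I * exp (- (\<theta> * card I * v\<^sup>2)))"
    using \<theta> by (simp add: ennreal_power ennreal_mult[symmetric] mult.commute)
  finally show ?thesis
    using \<theta> by (subst (asm) ennreal_le_iff) (auto simp: abs_tail_def)
qed

text \<open>The density on the interval is at least its value at \<open>s * w\<close>, and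
  multiplying by the length \<open>s\<close> cancels the scale.\<close>

lemma prob_normal_interval_ge:
  assumes X: "distributed M lborel X (normal_density 0 s)" and s: "0 < s"
    and A: "\<And>x. x \<in> {a..a + s} \<Longrightarrow> \<bar>x\<bar> \<le> s * w"
  shows "exp (- w\<^sup>2 / 2) / sqrt (2 * pi) \<le> prob (X -` {a..a + s} \<inter> space M)"
proof -
  have w: "0 \<le> s * w" using A[of a] s by auto
  have "exp (- w\<^sup>2 / 2) / sqrt (2 * pi) = normal_density 0 s (s * w) * s"
    using s by (simp add: normal_density_def real_sqrt_mult power_mult_distrib)
  also have "\<dots> = (\<integral>x. normal_density 0 s (s * w) * indicator {a..a + s} x \<partial>lborel)"
    using s by simp
  also have "\<dots> \<le> (\<integral>x. normal_density 0 s x * indicator {a..a + s} x \<partial>lborel)"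
    using s w A
    by (intro integral_mono integrable_mult_right integrable_real_indicator integrable_real_mult_indicator integrable_normal_density)
      (auto simp: indicator_def intro!: normal_density_antimono_abs)
  also have "\<dots> = prob (X -` {a..a + s} \<inter> space M)"
    using X by (intro prob_distributed_eq_integral[symmetric]) auto
  finally show ?thesis .
qed

lemma prob_prod_normal_le_ge:
  fixes X :: "'i \<Rightarrow> 'a \<Rightarrow> real"
  assumes I: "finite I" "I \<noteq> {}"
    and s: "\<And>i. i \<in> I \<Longrightarrow> 0 < s i"
    and X: "\<And>i. i \<in> I \<Longrightarrow> distributed M lborel (X i) (normal_density 0 (s i))"
    and indep: "indep_vars (\<lambda>_. borel) X I"
    and v: "0 < v"
  shows "(exp (- (v + 1)\<^sup>2 / 2) / sqrt (2 * pi)) ^ card I \<le>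
    prob {\<omega> \<in> space M. (\<Prod>i\<in>I. X i \<omega>) \<le> - ((\<Prod>i\<in>I. s i) * v ^ card I)}"
proof -
  have [measurable]: "X i \<in> borel_measurable M" if "i \<in> I" for i
    using distributed_measurable[OF X[OF that]] by simp
  obtain k where k: "k \<in> I" using I by auto
  \<comment> \<open>Coordinate \<open>k\<close> gets the interval from
    \<open>- s k * (v + 1)\<close> to \<open>- s k * v\<close>, the others lie between
    \<open>s i * v\<close> and \<open>s i * (v + 1)\<close>. Exactly one factor is negative, and
    every absolute value is at most \<open>s i * (v + 1)\<close>.\<close>
  define a where "a = (\<lambda>i. if i = k then - (s i * (v + 1)) else s i * v)"
  let ?A = "\<lambda>i. {a i..a i + s i}"
  have "(exp (- (v + 1)\<^sup>2 / 2) / sqrt (2 * pi)) ^ card I = (\<Prod>i\<in>I. exp (- (v + 1)\<^sup>2 / 2) / sqrt (2 * pi))"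
    by simp
  also have "\<dots> \<le> (\<Prod>i\<in>I. prob (X i -` ?A i \<inter> space M))"
  proof (intro prod_mono conjI prob_normal_interval_ge X s)
    fix i x assume "i \<in> I" "x \<in> ?A i"
    then show "\<bar>x\<bar> \<le> s i * (v + 1)"
      using mult_pos_pos[OF s v] s[of i] by (fastforce simp: a_def abs_le_iff algebra_simps split: if_splits)
  qed auto
  also have "\<dots> = prob (\<Inter>i\<in>I. X i -` ?A i \<inter> space M)"
    using I by (intro indep_varsD_finite[OF indep, symmetric]) auto
  also have "\<dots> \<le> prob {\<omega> \<in> space M. (\<Prod>i\<in>I. X i \<omega>) \<le> - ((\<Prod>i\<in>I. s i) * v ^ card I)}"
  proof (rule finite_measure_mono)
    show "{\<omega> \<in> space M. (\<Prod>i\<in>I. X i \<omega>) \<le> - ((\<Prod>i\<in>I. s i) * v ^ card I)} \<in> sets M"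
      using I by measurable
    show "(\<Inter>i\<in>I. X i -` ?A i \<inter> space M) \<subseteq> {\<omega> \<in> space M. (\<Prod>i\<in>I. X i \<omega>) \<le> - ((\<Prod>i\<in>I. s i) * v ^ card I)}"
    proof
      fix \<omega> assume \<omega>: "\<omega> \<in> (\<Inter>i\<in>I. X i -` ?A i \<inter> space M)"
      have space: "\<omega> \<in> space M" using \<omega> k by blast
      have mem: "X i \<omega> \<in> ?A i" if "i \<in> I" for i using \<omega> that by blast
      have "s k * v \<le> - X k \<omega>" using mem[OF k] by (simp add: a_def algebra_simps)
      moreover have "0 \<le> s i * v" "s i * v \<le> X i \<omega>" if "i \<in> I - {k}" for i
        using mem[of i] s[of i] v that by (auto simp: a_def)
      then have "(\<Prod>i\<in>I - {k}. s i * v) \<le> (\<Prod>i\<in>I - {k}. X i \<omega>)" "0 \<le> (\<Prod>i\<in>I - {k}. s i * v)"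
        by (auto intro!: prod_mono prod_nonneg)
      moreover have "0 \<le> s k * v" using s[OF k] v by simp
      ultimately have "s k * v * (\<Prod>i\<in>I - {k}. s i * v) \<le> - X k \<omega> * (\<Prod>i\<in>I - {k}. X i \<omega>)"
        by (intro mult_mono) linarith+
      then have "(\<Prod>i\<in>I. s i * v) \<le> - (\<Prod>i\<in>I. X i \<omega>)"
        using I k by (simp add: prod.remove[of I k])
      then show "\<omega> \<in> {\<omega> \<in> space M. (\<Prod>i\<in>I. X i \<omega>) \<le> - ((\<Prod>i\<in>I. s i) * v ^ card I)}"
        using space by (simp add: prod.distrib)
    qed
  qed
  finally show ?thesis .
qed

text \<open>Scaling the candidate by \<open>c\<close> multiplies the exponent of the tail by
  \<open>c powr (2 / n)\<close>, with \<open>n\<close> the number of factors. Tail bounds of the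
  right logarithmic order therefore suffice to decide the comparison with \<open>p\<close>.\<close>

lemma quantile_prod_normal:
  fixes X :: "'i \<Rightarrow> 'a \<Rightarrow> real"
  assumes I: "finite I" "I \<noteq> {}"
    and s: "\<And>i. i \<in> I \<Longrightarrow> 0 < s i"
    and X: "\<And>i. i \<in> I \<Longrightarrow> distributed M lborel (X i) (normal_density 0 (s i))"
    and indep: "indep_vars (\<lambda>_. borel) X I"
  shows "quantile (distr M borel (\<lambda>\<omega>. \<Prod>i\<in>I. X i \<omega>)) \<sim>[at_right 0]
     (\<lambda>p. - ((2 * (\<Prod>i\<in>I. s i) powr (2 / real (card I)) / real (card I) * ln (1 / p)) powr (real (card I) / 2)))"
    (is "_ \<sim>[_] (\<lambda>p. - ?q p)")
proof (rule quantile_asymp_equiv_neg)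
  define S n where "S = (\<Prod>i\<in>I. s i)" and "n = card I"
  have S: "0 < S" unfolding S_def using s by (rule prod_pos)
  have n: "0 < n" using I by (simp add: n_def card_gt_0_iff)
  have [measurable]: "X i \<in> borel_measurable M" if "i \<in> I" for i
    using distributed_measurable[OF X[OF that]] by simp
  have Z_rv: "random_variable borel (\<lambda>\<omega>. \<Prod>i\<in>I. X i \<omega>)" by measurable
  then show "real_distribution (distr M borel (\<lambda>\<omega>. \<Prod>i\<in>I. X i \<omega>))"
    by (rule real_distribution_distr)
  have ev: "\<forall>\<^sub>F p::real in at_right 0. p \<in> {0<..<1}"
    by (rule eventually_at_right_real) simp
  then show "\<forall>\<^sub>F p in at_right 0. 0 < ?q p"
    by eventually_elim (use S n in \<open>auto simp: ln_div S_def n_def\<close>)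
  \<comment> \<open>This writes the scaled candidate as \<open>S * v ^ n\<close>, the form used in
    both tail bounds, with \<open>n * v\<^sup>2 / 2 = c powr (2 / n) * ln (1 / p)\<close>.\<close>
  have cq: "c * ?q p = S * (sqrt (c powr (2 / n) * (2 / n) * ln (1 / p))) ^ n"
    "0 < sqrt (c powr (2 / n) * (2 / n) * ln (1 / p))"
    if "0 < c" "p \<in> {0<..<1}" for c p
  proof -
    have l: "0 < ln (1 / p)" using that by (auto simp: ln_div)
    then show pos: "0 < sqrt (c powr (2 / n) * (2 / n) * ln (1 / p))"
      using n that by simp
    have half: "(c powr (2 / n) * (2 / n) * ln (1 / p)) powr (1 / 2) = sqrt (c powr (2 / n) * (2 / n) * ln (1 / p))"
      using pos[unfolded real_sqrt_gt_0_iff] by (intro powr_half_sqrt less_imp_le)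
    have "(sqrt (c powr (2 / n) * (2 / n) * ln (1 / p))) ^ n = ((c powr (2 / n) * (2 / n) * ln (1 / p)) powr (1 / 2)) powr n"
      unfolding half using powr_realpow[OF pos, of n] by (rule sym)
    also have "\<dots> = (c powr (2 / n) * ((2 / n) * ln (1 / p))) powr (n / 2)"
      unfolding powr_powr by (simp add: mult.assoc)
    also have "\<dots> = c * ((2 / n) * ln (1 / p)) powr (n / 2)"
      using that n l by (subst powr_mult) (simp_all add: powr_powr)
    finally have 1: "(sqrt (c powr (2 / n) * (2 / n) * ln (1 / p))) ^ n = \<dots>" .
    have "?q p = (S powr (2 / n) * ((2 / n) * ln (1 / p))) powr (n / 2)"
      by (simp add: S_def n_def mult_ac)
    also have "\<dots> = S * ((2 / n) * ln (1 / p)) powr (n / 2)"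
      using S n l by (subst powr_mult) (simp_all add: powr_powr)
    finally have 2: "?q p = S * ((2 / n) * ln (1 / p)) powr (n / 2)" .
    show "c * ?q p = S * (sqrt (c powr (2 / n) * (2 / n) * ln (1 / p))) ^ n"
      unfolding 1 2 by simp
  qed
  have at_top: "filterlim (\<lambda>p::real. ln (1 / p)) at_top (at_right 0)" by real_asymp
  fix c :: real
  {
    assume c: "1 < c"
    define d where "d = c powr (2 / n)"
    have d: "1 < d" using c n by (simp add: d_def)
    \<comment> \<open>Chosen so that \<open>2 * \<theta> * d\<close> is the midpoint of 1 and
      \<open>d\<close>: the bound then decays like a power of \<open>p\<close> with exponent above
      1, which absorbs the constant \<open>K\<close>.\<close>
    define \<theta> where "\<theta> = (d + 1) / (4 * d)"
    have \<theta>: "0 < \<theta>" "\<theta> < 1 / 2" "2 * \<theta> * d = (d + 1) / 2"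
      using d by (auto simp: \<theta>_def field_simps)
    define K where "K = (1 / sqrt (1 - 2 * \<theta>)) ^ n"
    have "0 < K" using \<theta> by (simp add: K_def)
    have "\<forall>\<^sub>F l in at_top. K * exp (- ((d + 1) / 2 * l)) < exp (- l)"
      using d \<open>0 < K\<close> by real_asymp
    from eventually_compose_filterlim[OF this at_top] ev
    show "\<forall>\<^sub>F p in at_right 0. cdf (distr M borel (\<lambda>\<omega>. \<Prod>i\<in>I. X i \<omega>)) (- (c * ?q p)) < p"
    proof eventually_elim
      case (elim p)
      let ?l = "ln (1 / p)" and ?v = "sqrt (d * (2 / n) * ln (1 / p))"
      have v: "c * ?q p = S * ?v ^ n" "0 < ?v" using cq[of c p] c elim by (auto simp: d_def)
      have v2: "?v\<^sup>2 = d * (2 / n) * ?l" 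
        using v(2)[unfolded real_sqrt_gt_0_iff] by (intro real_sqrt_pow2 less_imp_le)
      have "cdf (distr M borel (\<lambda>\<omega>. \<Prod>i\<in>I. X i \<omega>)) (- (c * ?q p)) \<le> abs_tail (\<lambda>\<omega>. \<Prod>i\<in>I. X i \<omega>) (S * ?v ^ n)"
        unfolding cdf_distr_eq_prob[OF Z_rv] v(1) abs_tail_def
        using I by (intro finite_measure_mono) auto
      also have "\<dots> \<le> K * exp (- (\<theta> * n * ?v\<^sup>2))"
        unfolding K_def S_def n_def
        using v(2) unfolding n_def by (intro abs_tail_prod_normal_le I s X indep \<theta>) auto
      also have "\<theta> * n * ?v\<^sup>2 = 2 * \<theta> * d * ?l" unfolding v2 using n by simp
      also have "K * exp (- (2 * \<theta> * d * ?l)) < exp (- ?l)" using elim unfolding \<theta>(3) by simp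
      also have "exp (- ?l) = p" using elim by (simp add: ln_div)
      finally show ?case .
    qed
  next
    assume c: "0 < c" "c < 1"
    define d where "d = c powr (2 / n)"
    have d: "0 < d" "d < 1" using c n powr_less_mono2[of "2 / n" c 1] by (auto simp: d_def)
    \<comment> \<open>This moves the normalising constant of each density into the exponent.\<close>
    define b where "b = ln (sqrt (2 * pi))"
    \<comment> \<open>With \<open>l = ln (1 / p)\<close>, the shift from \<open>v\<close> to
      \<open>v + 1\<close> costs only order \<open>sqrt l\<close>, which the linear gain
      \<open>(1 - d) * l\<close> outweighs.\<close>
    have "filterlim (\<lambda>l. (1 - d) * l - n * sqrt (d * (2 / n)) * sqrt l - (n / 2 + n * b)) at_top at_top"
      using d n by real_asymp
    then have "\<forall>\<^sub>F l in at_top. 0 \<le> (1 - d) * l - n * sqrt (d * (2 / n)) * sqrt l - (n / 2 + n * b)"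
      unfolding filterlim_at_top by blast
    from eventually_compose_filterlim[OF this at_top] ev
    show "\<forall>\<^sub>F p in at_right 0. p \<le> cdf (distr M borel (\<lambda>\<omega>. \<Prod>i\<in>I. X i \<omega>)) (- (c * ?q p))"
    proof eventually_elim
      case (elim p)
      let ?l = "ln (1 / p)"
      define v where "v = sqrt (d * (2 / n) * ?l)"
      have v: "c * ?q p = S * v ^ n" "0 < v" using cq[of c p] c elim by (auto simp: d_def v_def)
      have "v\<^sup>2 = d * (2 / n) * ?l"
        using v(2)[unfolded v_def real_sqrt_gt_0_iff] unfolding v_def by (intro real_sqrt_pow2 less_imp_le)
      then have v2: "n * v\<^sup>2 = 2 * (d * ?l)" using n by simp
      have "n * sqrt (d * (2 / n)) * sqrt ?l = n * v"
        unfolding v_def real_sqrt_mult[of "d * (2 / n)"] by (rule mult.assoc)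
      with elim(1) have "0 \<le> (1 - d) * ?l - n * v - (n / 2 + n * b)" by (simp only:)
      also have "\<dots> = ?l + n * (- (v + 1)\<^sup>2 / 2 - b)"
        using v2 by (simp add: power2_eq_square field_simps)
      finally have exponent: "- ?l \<le> n * (- (v + 1)\<^sup>2 / 2 - b)" by simp
      have "p = exp (- ?l)" using elim by (simp add: ln_div)
      also have "\<dots> \<le> exp (n * (- (v + 1)\<^sup>2 / 2 - b))" using exponent by (rule iffD2[OF exp_le_cancel_iff])
      also have "\<dots> = (exp (- (v + 1)\<^sup>2 / 2) / sqrt (2 * pi)) ^ n"
        by (simp only: exp_of_nat_mult exp_diff b_def) simp
      also have "\<dots> \<le> prob {\<omega> \<in> space M. (\<Prod>i\<in>I. X i \<omega>) \<le> - (S * v ^ n)}"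
        unfolding S_def n_def using v(2) by (intro prob_prod_normal_le_ge I s X indep) auto
      finally show ?case unfolding cdf_distr_eq_prob[OF Z_rv] v(1) .
    qed
  }
qed

end

section \<open>The two regimes of the quotient\<close>

theorem theorem2p8:
  fixes P :: "'a measure"
    and M N :: nat
    and X Y :: "nat \<Rightarrow> 'a \<Rightarrow> real"
    and \<sigma>X \<sigma>Y :: "nat \<Rightarrow> real"
    and Z :: "'a \<Rightarrow> real"
    and Q :: "real \<Rightarrow> real"
  assumes "prob_space P"
    and "\<And>i. i \<in> {1..M} \<Longrightarrow> \<sigma>X i > 0"
    and "\<And>j. j \<in> {1..N} \<Longrightarrow> \<sigma>Y j > 0"
    and "\<And>i. i \<in> {1..M} \<Longrightarrow> distributed P lborel (X i) (normal_density 0 (\<sigma>X i))"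
    and "\<And>j. j \<in> {1..N} \<Longrightarrow> distributed P lborel (Y j) (normal_density 0 (\<sigma>Y j))"
    and "prob_space.indep_vars P (\<lambda>_. borel) (case_sum X Y) ({1..M} <+> {1..N})"
    and "Z = (\<lambda>\<omega>. (\<Prod>i=1..M. X i \<omega>) / (\<Prod>j=1..N. Y j \<omega>))"
    and "Q = quantile (distr P borel Z)"
  shows "(N \<ge> 1 \<longrightarrow>
           Q \<sim>[at_right 0]
             (\<lambda>p. - (2 powr ((real M + real N - 2) / 2) * (\<Prod>i=1..M. \<sigma>X i)
                     / (pi powr ((real M + real N) / 2) * (\<Prod>j=1..N. \<sigma>Y j) * fact (N - 1))
                   * (ln (1 / p) ^ (N - 1) / p)))) \<and>
         (M \<ge> 1 \<and> N = 0 \<longrightarrow>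
           Q \<sim>[at_right 0]
             (\<lambda>p. - ((2 * (\<Prod>i=1..M. \<sigma>X i) powr (2 / real M) / real M * ln (1 / p))
                     powr (real M / 2))))"
proof (intro conjI impI)
  interpret prob_space P by fact
  assume "1 \<le> N"
  then show "Q \<sim>[at_right 0]
      (\<lambda>p. - (2 powr ((real M + real N - 2) / 2) * (\<Prod>i=1..M. \<sigma>X i)
              / (pi powr ((real M + real N) / 2) * (\<Prod>j=1..N. \<sigma>Y j) * fact (N - 1))
            * (ln (1 / p) ^ (N - 1) / p)))"
    unfolding assms(7,8) by (intro quantile_prod_div_prod_normal assms(2-6))
next
  interpret prob_space P by fact
  assume MN: "1 \<le> M \<and> N = 0"
  \<comment> \<open>For \<open>N = 0\<close> the denominator is the empty product 1, so only the
    left summand of the index type remains.\<close>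
  let ?I = "Inl ` {1..M} :: (nat + nat) set"
  have "indep_vars (\<lambda>_. borel) (case_sum X Y) ?I"
    using assms(6) by (rule indep_vars_subset) (auto simp: Plus_def)
  moreover have "0 < case_sum \<sigma>X \<sigma>Y i"
    "distributed P lborel (case_sum X Y i) (normal_density 0 (case_sum \<sigma>X \<sigma>Y i))" if "i \<in> ?I" for i
    using that assms(2,4) by auto
  ultimately have "quantile (distr P borel (\<lambda>\<omega>. \<Prod>i\<in>?I. case_sum X Y i \<omega>)) \<sim>[at_right 0]
     (\<lambda>p. - ((2 * (\<Prod>i\<in>?I. case_sum \<sigma>X \<sigma>Y i) powr (2 / real (card ?I)) / real (card ?I) * ln (1 / p))
       powr (real (card ?I) / 2)))"
    using MN by (intro quantile_prod_normal) auto
  moreover have "Z = (\<lambda>\<omega>. \<Prod>i\<in>?I. case_sum X Y i \<omega>)"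
    using MN by (simp add: assms(7) prod.reindex)
  ultimately show "Q \<sim>[at_right 0]
      (\<lambda>p. - ((2 * (\<Prod>i=1..M. \<sigma>X i) powr (2 / real M) / real M * ln (1 / p)) powr (real M / 2)))"
    by (simp add: assms(8) prod.reindex card_image comp_def)
qed

end
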